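(* The set of pairs of unit rhombi $\rho_1,\rho_2\in\mathcal{M}_4$ such that $\rho_1\cup\rho_2$ is orientably cobordant to a third unit rhombus $\rho_3\in\mathcal{M}_4$ has measure $0$.
   Context: Let $\mathbb{E}$ denote three-dimensional Euclidean space. An integral curve is a closed piecewise linear curve in $\mathbb{E}$ all of whose intervals (edges) have unit length. $\mathcal{M}_n$ is the set of all integral curves $[v_1\dots v_n]$ of length $n$ ($|v_i-v_{i+1}|=1$, $v_{n+1}=v_1$); elements of $\mathcal{M}_4$ are called unit rhombi (any closed 4-gon with unit edges, not necessarily planar). Domes. Let $\gamma_1,\dots,\gamma_r$ be integral curves. A dome over $\gamma_1\cup\dots\cup\gamma_r$ is a piecewise linear complex in $\mathbb{E}$ whose facets are all unit equilateral triangles and whose boundary is $\gamma_1\cup\dots\cup\gamma_r$. It need not be embedded or immersed: it is the image of a finite abstract simplicial surface complex under a map to $\mathbb{E}$ that is isometric on unit edges and unit triangles. When the boundary curves share edges, the dome need not be purely 2-dimensional (it may contain edges lying in no triangle). The closure of an integral curve $\gamma_i$ is the surface formed by gluing the boundary of an (abstract) disk to $\gamma_i$. The dome is orientable if, combinatorially, the dome together with the closures of all of $\gamma_1,\dots,\gamma_r$ forms a closed orientable surface; equivalently, the underlying complex $S$ is contained in a closed orientable surface $\widehat{S}$ such that $\widehat{S}\smallsetminus S$ is a disjoint union of $r$ open disks whose boundary curves map to $\gamma_1,\dots,\gamma_r$. Then $\rho_1\cup\rho_2$ is orientably cobordant to $\rho_3$ if there is an orientable dome over $\rho_1\cup\rho_2\cup\rho_3$.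 Measure. Pairs are considered in the product of moduli spaces $(\mathcal{M}_4/\mathrm{Isom}^+\mathbb{E})\times(\mathcal{M}_4/\mathrm{Isom}^+\mathbb{E})$, where $\mathrm{Isom}^+\mathbb{E}$ is the group of orientation-preserving isometries of $\mathbb{E}$, acting on each of the two rhombi separately; thus a pair of classes belongs to the set if for some representatives $\rho_1,\rho_2$, in any position relative to each other, $\rho_1\cup\rho_2$ is orientably cobordant to some unit rhombus. Each factor is a 2-dimensional smooth manifold away from the classes of rhombi with all edges parallel, and "measure $0$" is meant with respect to the Lebesgue measure class on this 4-dimensional product (the lower-dimensional singular locus being null). *)

theory Defs
  imports "HOL-Analysis.Analysis"
begin

section \<open>Integral curves and their moduli\<close>

text \<open>The closed curve \<open>[v\<^sub>1 \<dots> v\<^sub>n]\<close> is the list of its vertices; all indices are read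
  cyclically, so the last edge goes from the last vertex back to the first.\<close>

definition integral_curves :: "nat \<Rightarrow> (real^3) list set" where
  "integral_curves n =
     {v. length v = n \<and> (\<forall>i<n. dist (v ! i) (v ! (Suc i mod n)) = 1)}"

abbreviation unit_rhombi :: "(real^3) list set" where
  "unit_rhombi \<equiv> integral_curves 4"

definition isom_plus :: "(real^3 \<Rightarrow> real^3) set" where
  "isom_plus = {g. \<exists>A b. rotation_matrix A \<and> g = (\<lambda>x. A *v x + b)}"

definition congruence :: "nat \<Rightarrow> ((real^3) list \<times> (real^3) list) set" where
  "congruence n = {(v, w). v \<in> integral_curves n \<and> w \<in> integral_curves n \<and>
                           (\<exists>g\<in>isom_plus. w = map g v)}"

definition rhombus_class :: "(real^3) list \<Rightarrow> (real^3) list set" where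
  "rhombus_class \<rho> = congruence 4 `` {\<rho>}"

definition rhombus_moduli :: "(real^3) list set set" where
  "rhombus_moduli = unit_rhombi // congruence 4"


section \<open>Closed surfaces glued from polygons\<close>

text \<open>A polygon is given by the closed walk its boundary follows in the 1-skeleton. The walk may
  repeat vertices and edges, i.e. only the open polygon is embedded in the surface. An edge of the
  1-skeleton is determined by its two endpoints.\<close>

definition sides :: "'a list \<Rightarrow> ('a \<times> 'a) list" where
  "sides w = map (\<lambda>i. (w ! i, w ! (Suc i mod length w))) [0..<length w]"

definition edges :: "'a list list \<Rightarrow> 'a set list" where
  "edges Fs = map (\<lambda>(a, b). {a, b}) (concat (map sides Fs))"

text \<open>The link of a vertex \<open>v\<close> is the graph whose nodes are the neighbours of \<open>v\<close> and which has one
  arc for each polygon corner at \<open>v\<close>, joining the vertices before and after that corner.\<close>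

definition link_adj :: "'a list list \<Rightarrow> 'a \<Rightarrow> ('a \<times> 'a) set" where
  "link_adj Fs v =
     {(p, s). \<exists>w\<in>set Fs. \<exists>i<length w.
        w ! (Suc i mod length w) = v \<and>
        ((p = w ! i \<and> s = w ! (Suc (Suc i) mod length w)) \<or>
         (s = w ! i \<and> p = w ! (Suc (Suc i) mod length w)))}"

text \<open>Every edge borders exactly two polygon sides (possibly of the same polygon). Then each node of
  a vertex link has degree two, so a link is a circle precisely when it is connected. The surface
  need not be connected.\<close>

definition closed_surface :: "'a list list \<Rightarrow> bool" where
  "closed_surface Fs \<longleftrightarrow>
     (\<forall>e\<in>set (edges Fs). card e = 2 \<and> count_list (edges Fs) e = 2) \<and>
     (\<forall>v a b. {v, a} \<in> set (edges Fs) \<and> {v, b} \<in> set (edges Fs) \<longrightarrow>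
        (a, b) \<in> (link_adj Fs v)\<^sup>*)"

text \<open>Orientability: the polygons can be oriented so that no edge is traversed twice in the same
  direction, i.e. the two sides at each edge receive opposite directions.\<close>

definition orientable :: "'a list list \<Rightarrow> bool" where
  "orientable Fs \<longleftrightarrow>
     (\<exists>Gs. list_all2 (\<lambda>F G. G = F \<or> G = rev F) Fs Gs \<and> distinct (concat (map sides Gs)))"


section \<open>Orientable domes\<close>

text \<open>The underlying simplicial complex \<open>S\<close> has the triangles \<open>set ` set Ts\<close> and all edges and
  vertices of \<open>Ts @ ws\<close>; an edge lying only on walks in \<open>ws\<close> is an edge in no triangle. The closed
  surface containing \<open>S\<close> is obtained by attaching one open disk along each walk in \<open>ws\<close>. The map to
  Euclidean space, being isometric on unit edges and triangles, is determined by its values \<open>f\<close> on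
  vertices. As complexes are finite, vertices may be taken to be natural numbers.\<close>

definition orientable_dome ::
  "nat list list \<Rightarrow> nat list list \<Rightarrow> (nat \<Rightarrow> real^3) \<Rightarrow> (real^3) list list \<Rightarrow> bool" where
  "orientable_dome Ts ws f \<gamma>s \<longleftrightarrow>
     (\<forall>t\<in>set Ts. length t = 3) \<and> distinct (map set Ts) \<and>
     closed_surface (Ts @ ws) \<and> orientable (Ts @ ws) \<and>
     (\<forall>a b. {a, b} \<in> set (edges (Ts @ ws)) \<longrightarrow> dist (f a) (f b) = 1) \<and>
     map (map f) ws = \<gamma>s"

definition orientably_cobordant ::
  "(real^3) list \<Rightarrow> (real^3) list \<Rightarrow> (real^3) list \<Rightarrow> bool" where
  "orientably_cobordant \<rho>\<^sub>1 \<rho>\<^sub>2 \<rho>\<^sub>3 \<longleftrightarrow> (\<exists>Ts ws f. orientable_dome Ts ws f [\<rho>\<^sub>1, \<rho>\<^sub>2, \<rho>\<^sub>3])"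


section \<open>Sets of measure zero in the product of moduli spaces\<close>

definition all_edges_parallel :: "(real^3) list \<Rightarrow> bool" where
  "all_edges_parallel v \<longleftrightarrow>
     (\<exists>u. \<forall>i<length v. \<exists>c. v ! (Suc i mod length v) - v ! i = c *\<^sub>R u)"

text \<open>Local parametrizations of the 2-manifold of classes of rhombi with not all edges parallel,
  given by a lift \<open>\<sigma>\<close> to rhombi. The tangent space of the orbit through \<open>v\<close> under
  orientation-preserving isometries consists of the fields \<open>v ! i \<mapsto> cross3 a (v ! i) + b\<close>, so the
  last condition on \<open>D\<close> says that \<open>x \<mapsto> rhombus_class (\<sigma> x)\<close> is an immersion between manifolds of
  dimension two; being injective as well, it is a diffeomorphism onto an open set.
  Parametrizations of class \<open>C\<^sup>1\<close> define the same null sets as smooth ones.\<close>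

definition moduli_chart :: "(real^2) set \<Rightarrow> (real^2 \<Rightarrow> (real^3) list) \<Rightarrow> bool" where
  "moduli_chart U \<sigma> \<longleftrightarrow>
     open U \<and>
     (\<forall>x\<in>U. \<sigma> x \<in> unit_rhombi \<and> \<not> all_edges_parallel (\<sigma> x)) \<and>
     inj_on (\<lambda>x. rhombus_class (\<sigma> x)) U \<and>
     (\<exists>D :: nat \<Rightarrow> real^2 \<Rightarrow> real^2 \<Rightarrow> real^3.
        (\<forall>i<4. \<forall>x\<in>U. ((\<lambda>y. \<sigma> y ! i) has_derivative D i x) (at x)) \<and>
        (\<forall>i<4. \<forall>h. continuous_on U (\<lambda>x. D i x h)) \<and>
        (\<forall>x\<in>U. \<forall>h a b. (\<forall>i<4. D i x h = cross3 a (\<sigma> x ! i) + b) \<longrightarrow> h = 0))"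

text \<open>Null sets for the Lebesgue measure class of the product 4-manifold: null in every product
  chart. Classes of rhombi with all edges parallel lie in no chart, and pairs involving such a class
  do not affect nullity.\<close>

definition moduli_pair_null :: "((real^3) list set \<times> (real^3) list set) set \<Rightarrow> bool" where
  "moduli_pair_null A \<longleftrightarrow>
     (\<forall>U \<sigma> V \<tau>. moduli_chart U \<sigma> \<and> moduli_chart V \<tau> \<longrightarrow>
        {(x, y). x \<in> U \<and> y \<in> V \<and> (rhombus_class (\<sigma> x), rhombus_class (\<tau> y)) \<in> A}
          \<in> null_sets lebesgue)"

end

(*
  A unit rhombus with edge vectors e_i carries the 2-form
    omega (D, D') = sum_i e_i . (D e_i x D' e_i),
  where D and D' are derivations of the field of real numbers, acting on coordinates. A summand
  changes sign when the edge is reversed, so over a coherently oriented closed surface the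
  contributions of all edges cancel. Triangles contribute 0: they are rigid, so D acts on their
  edges as an infinitesimal rotation. Hence +- omega_1 +- omega_2 +- omega_3 = 0 whenever rho_1
  and rho_2 are orientably cobordant to rho_3.

  On a rhombus, omega is a multiple of dalpha /\ dbeta for the cosines alpha = e_1 . e_2 and
  beta = e_2 . e_3, so the rank of omega_3 is at most 2. If alpha_1, beta_1, alpha_2, beta_2 are
  algebraically independent over the integers, there are derivations dual to them and
  +- omega_1 +- omega_2 has rank 4, a contradiction. Finally, alpha and beta are local coordinates
  on the moduli space outside the null set of planar rhombi, and algebraically dependent
  quadruples of reals form a null set.
*)

theory Submission
  imports Defs "HOL-Computational_Algebra.Polynomial"
begin

section \<open>Derivations of the real numbers\<close>

text \<open>Derivations stand in for deformations: nothing guarantees that a given dome can be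
  moved, so there is no family of domes to differentiate. But the squared edge lengths and the inner
  products of sides of a unit triangle are rational, and every derivation kills the rationals.
  Applied to all vertex coordinates at once, a derivation therefore acts as an infinitesimal motion
  of any dome, whatever its combinatorics. As the coordinates of inner vertices can be any reals,
  the derivations have to live on all of \<real>. Their values are prescribed only on the four
  independent cosines, so there is no control over what they do to the third rhombus. None is
  needed: a 2-form of rank at most 2 is decomposable and has wedge square 0, whereas the wedge
  square of +-omega_1 +- omega_2 is, up to sign, twice the product of omega_1 and omega_2, which is
  nonzero.\<close>

definition derivation :: "(real \<Rightarrow> real) \<Rightarrow> bool" where
  "derivation D \<longleftrightarrow> (\<forall>x y. D (x + y) = D x + D y \<and> D (x * y) = D x * y + x * D y)"

text \<open>The graph of a derivation on a subring of the reals is a subring of the dual numbers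
  \<open>\<real>[\<epsilon>]\<close>, with \<open>(a, b)\<close> standing for \<open>a + \<epsilon>b\<close>, that meets \<open>\<real>\<epsilon>\<close> only in 0.\<close>

definition dual_graph :: "(real \<times> real) set \<Rightarrow> bool" where
  "dual_graph G \<longleftrightarrow> (1, 0) \<in> G \<and>
     (\<forall>a a' b b'. (a, a') \<in> G \<longrightarrow> (b, b') \<in> G \<longrightarrow>
        (a - b, a' - b') \<in> G \<and> (a * b, a' * b + a * b') \<in> G) \<and>
     (\<forall>b. (0, b) \<in> G \<longrightarrow> b = 0)"

lemma dual_graphD:
  assumes "dual_graph G"
  shows "(1, 0) \<in> G"
    and "(a, a') \<in> G \<Longrightarrow> (b, b') \<in> G \<Longrightarrow> (a - b, a' - b') \<in> G"
    and "(a, a') \<in> G \<Longrightarrow> (b, b') \<in> G \<Longrightarrow> (a * b, a' * b + a * b') \<in> G"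
    and "(0, b) \<in> G \<Longrightarrow> b = 0"
  using assms unfolding dual_graph_def by blast+

lemma dual_graph_zero: "dual_graph G \<Longrightarrow> (0, 0) \<in> G"
  using dual_graphD(2)[of G 1 0 1 0] dual_graphD(1)[of G] by simp

lemma dual_graph_add:
  assumes "dual_graph G" "(a, a') \<in> G" "(b, b') \<in> G"
  shows "(a + b, a' + b') \<in> G"
proof -
  have "(0 - b, 0 - b') \<in> G"
    using assms dual_graphD(2) dual_graph_zero by blast
  from dual_graphD(2)[OF assms(1,2) this] show ?thesis by simp
qed

lemma dual_graph_sum:
  assumes "dual_graph G" "\<And>i. i \<in> I \<Longrightarrow> (f i, g i) \<in> G"
  shows "(sum f I, sum g I) \<in> G"
  using assms(2)
  by (induction I rule: infinite_finite_induct)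
     (auto simp: assms(1) dual_graph_zero intro: dual_graph_add)

lemma dual_graph_of_nat_mult:
  assumes "dual_graph G" "(a, a') \<in> G"
  shows "(of_nat n * a, of_nat n * a') \<in> G"
  by (induction n) (auto simp: assms dual_graph_zero distrib_right intro: dual_graph_add)

lemma dual_graph_unique:
  assumes "dual_graph G" "(a, b) \<in> G" "(a, b') \<in> G"
  shows "b = b'"
  using dual_graphD(4)[OF assms(1)] dual_graphD(2)[OF assms] by force

section \<open>Adjoining one dual number to the graph of a derivation\<close>

definition dual_polys :: "(real \<times> real) set \<Rightarrow> (real poly \<times> real poly) set" where
  "dual_polys G = {(p, q). \<forall>n. (coeff p n, coeff q n) \<in> G}"

text \<open>For \<open>P + \<epsilon>Q\<close> with coefficients in the dual numbers, the \<open>\<epsilon>\<close>-part of the value at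
  \<open>a + \<epsilon>b\<close>.\<close>

definition eps_part :: "real \<Rightarrow> real \<Rightarrow> real poly \<Rightarrow> real poly \<Rightarrow> real" where
  "eps_part a b p q = poly q a + poly (pderiv p) a * b"

text \<open>The subring G[a + \<epsilon>b] of the dual numbers.\<close>

definition dual_adjoin :: "(real \<times> real) set \<Rightarrow> real \<Rightarrow> real \<Rightarrow> (real \<times> real) set" where
  "dual_adjoin G a b = {(poly p a, eps_part a b p q) | p q. (p, q) \<in> dual_polys G}"

lemma dual_polys_diff:
  assumes "dual_graph G" "(p, q) \<in> dual_polys G" "(p', q') \<in> dual_polys G"
  shows "(p - p', q - q') \<in> dual_polys G"
  using assms by (auto simp: dual_polys_def intro: dual_graphD(2))

lemma dual_polys_mult:
  assumes "dual_graph G" "(p, q) \<in> dual_polys G" "(p', q') \<in> dual_polys G"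
  shows "(p * p', q * p' + p * q') \<in> dual_polys G"
  unfolding dual_polys_def
proof clarify
  fix n
  have "(\<Sum>i\<le>n. coeff p i * coeff p' (n - i),
         \<Sum>i\<le>n. coeff q i * coeff p' (n - i) + coeff p i * coeff q' (n - i)) \<in> G"
    using assms by (intro dual_graph_sum) (auto simp: dual_polys_def intro: dual_graphD(3))
  then show "(coeff (p * p') n, coeff (q * p' + p * q') n) \<in> G"
    by (simp add: coeff_mult sum.distrib)
qed

lemma dual_polys_monom:
  assumes "dual_graph G" "(c, c') \<in> G"
  shows "(monom c k, monom c' k) \<in> dual_polys G"
  using assms by (auto simp: dual_polys_def dual_graph_zero)

lemma eps_part_diff: "eps_part a b (p - p') (q - q') = eps_part a b p q - eps_part a b p' q'"
  by (simp add: eps_part_def pderiv_diff algebra_simps)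

lemma eps_part_mult:
  "eps_part a b (p * p') (q * p' + p * q') =
     eps_part a b p q * poly p' a + poly p a * eps_part a b p' q'"
  by (simp add: eps_part_def pderiv_mult algebra_simps)

lemma dual_adjoin_superset:
  assumes "dual_graph G"
  shows "G \<subseteq> dual_adjoin G a b" and "(a, b) \<in> dual_adjoin G a b"
proof -
  have "(c, c') \<in> dual_adjoin G a b" if "(c, c') \<in> G" for c c'
    using dual_polys_monom[OF assms that, of 0]
    by (force simp: dual_adjoin_def eps_part_def monom_0)
  then show "G \<subseteq> dual_adjoin G a b" by auto
  show "(a, b) \<in> dual_adjoin G a b"
    using dual_polys_monom[OF assms dual_graphD(1)[OF assms], of 1]
    unfolding dual_adjoin_def
    by (intro CollectI exI[of _ "monom 1 1"] exI[of _ "monom 0 1"])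
       (simp add: eps_part_def poly_monom pderiv_monom)
qed

text \<open>Values of polynomials at a dual number always form a ring. What can fail is
  single-valuedness: a relation satisfied by \<open>a\<close> must also be respected by
  \<open>b\<close>, and this is the hypothesis \<open>wd\<close>.\<close>

lemma dual_graph_adjoin:
  assumes G: "dual_graph G"
    and wd: "\<And>p q. (p, q) \<in> dual_polys G \<Longrightarrow> poly p a = 0 \<Longrightarrow> eps_part a b p q = 0"
  shows "dual_graph (dual_adjoin G a b)"
  unfolding dual_graph_def
proof (intro conjI allI impI)
  show "(1, 0) \<in> dual_adjoin G a b"
    using dual_adjoin_superset(1)[OF G] dual_graphD(1)[OF G] by blast
next
  fix c c' d d' assume "(c, c') \<in> dual_adjoin G a b" "(d, d') \<in> dual_adjoin G a b"
  then obtain p q p' q' where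
    *: "(p, q) \<in> dual_polys G" "(p', q') \<in> dual_polys G"
      "c = poly p a" "c' = eps_part a b p q" "d = poly p' a" "d' = eps_part a b p' q'"
    unfolding dual_adjoin_def by blast
  show "(c - d, c' - d') \<in> dual_adjoin G a b"
    using dual_polys_diff[OF G *(1,2)] unfolding *(3-6) dual_adjoin_def
    by (metis (mono_tags, lifting) eps_part_diff mem_Collect_eq poly_diff)
  show "(c * d, c' * d + c * d') \<in> dual_adjoin G a b"
    using dual_polys_mult[OF G *(1,2)] unfolding *(3-6) dual_adjoin_def
    by (metis (mono_tags, lifting) eps_part_mult mem_Collect_eq poly_mult)
next
  fix d assume "(0, d) \<in> dual_adjoin G a b"
  then show "d = 0" unfolding dual_adjoin_def using wd by auto
qed

definition transcendental_over :: "real set \<Rightarrow> real \<Rightarrow> bool" where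
  "transcendental_over R a \<longleftrightarrow> (\<forall>p. (\<forall>n. coeff p n \<in> R) \<and> poly p a = 0 \<longrightarrow> p = 0)"

lemma dual_polys_fst_zero:
  assumes "dual_graph G" "(0, q) \<in> dual_polys G"
  shows "q = 0"
  using assms by (auto simp: dual_polys_def poly_eq_iff intro: dual_graphD(4))

text \<open>Only the zero polynomial vanishes at \<open>a\<close>, so there is no relation to
  respect and \<open>b\<close> is arbitrary. This freedom is what later allows values of derivations
  to be prescribed.\<close>

lemma dual_graph_adjoin_transcendental:
  assumes G: "dual_graph G" and a: "transcendental_over (fst ` G) a"
  shows "dual_graph (dual_adjoin G a b)"
proof (rule dual_graph_adjoin[OF G])
  fix p q assume pq: "(p, q) \<in> dual_polys G" "poly p a = 0"
  then have "\<forall>n. coeff p n \<in> fst ` G"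
    by (force simp: dual_polys_def)
  then have "p = 0" using a pq(2) by (simp add: transcendental_over_def)
  then show "eps_part a b p q = 0"
    using dual_polys_fst_zero[OF G, of q] pq(1) by (simp add: eps_part_def)
qed

text \<open>An algebraic \<open>a\<close> leaves no choice: differentiating a relation
  \<open>m\<close> of least degree determines \<open>b\<close>. All other relations are then
  respected as well, by repeated pseudo-division by \<open>m\<close>.\<close>

lemma dual_graph_adjoin_exists:
  assumes G: "dual_graph G"
  shows "\<exists>b. dual_graph (dual_adjoin G a b)"
proof (cases "transcendental_over (fst ` G) a")
  case True
  then show ?thesis using dual_graph_adjoin_transcendental[OF G] by blast
next
  case False
  define Q where "Q p \<longleftrightarrow> p \<noteq> 0 \<and> poly p a = 0 \<and> (\<forall>n. coeff p n \<in> fst ` G)" for p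
  obtain z where "Q z" using False by (auto simp: transcendental_over_def Q_def)
  define m where "m = arg_min degree Q"
  have m: "Q m" and min: "\<And>p. Q p \<Longrightarrow> degree m \<le> degree p"
    unfolding m_def using arg_min_natI arg_min_nat_le \<open>Q z\<close> by metis+
  obtain c where c: "\<And>n. (coeff m n, c n) \<in> G"
  proof -
    have "\<exists>d. (coeff m n, d) \<in> G" for n
      using m unfolding Q_def by force
    then show ?thesis using that by metis
  qed
  define m' where "m' = Poly (map c [0..<Suc (degree m)])"
  have mm': "(m, m') \<in> dual_polys G"
  proof -
    have "(coeff m n, coeff m' n) \<in> G" for n
      using c[of n] dual_graph_zero[OF G]
      by (cases "n \<le> degree m") (auto simp: m'_def nth_default_def coeff_eq_0 simp del: upt_Suc)
    then show ?thesis by (simp add: dual_polys_def)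
  qed
  have deg: "degree m > 0"
  proof (rule ccontr)
    assume "\<not> degree m > 0"
    then obtain z where "m = [:z:]" by (metis degree_eq_zeroE gr0I)
    then show False using m by (auto simp: Q_def)
  qed
  \<comment> \<open>Otherwise the derivative would be a relation of smaller degree. It is not the
    zero polynomial because the characteristic is 0.\<close>
  have der: "poly (pderiv m) a \<noteq> 0"
  proof
    assume "poly (pderiv m) a = 0"
    moreover have "coeff (pderiv m) n \<in> fst ` G" for n
      using dual_graph_of_nat_mult[OF G c, of "Suc n" "Suc n"]
      by (force simp: coeff_pderiv simp del: of_nat_Suc)
    ultimately have "Q (pderiv m)"
      using deg by (auto simp: Q_def pderiv_eq_0_iff)
    from min[OF this] deg show False by (simp add: degree_pderiv)
  qed
  \<comment> \<open>The solution of \<open>eps_part a b m m' = 0\<close>.\<close>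
  define b where "b = - poly m' a / poly (pderiv m) a"
  have m0: "eps_part a b m m' = 0"
    using der by (simp add: eps_part_def b_def)
  have "eps_part a b p q = 0" if "(p, q) \<in> dual_polys G" "poly p a = 0" for p q
    using that
  proof (induction "degree p" arbitrary: p q rule: less_induct)
    case less
    show ?case
    proof (cases "p = 0")
      case True
      then show ?thesis using dual_polys_fst_zero[OF G, of q] less.prems(1) by (simp add: eps_part_def)
    next
      case False
      have "Q p" using False less.prems by (force simp: Q_def dual_polys_def)
      then have le: "degree m \<le> degree p" by (rule min)
      define k where "k = degree p - degree m"
      \<comment> \<open>The domain of \<open>G\<close> is only a ring, so
        \<open>lead_coeff m\<close> need not be invertible there. Hence \<open>p\<close> is
        multiplied by it before its leading term is cancelled, and the \<epsilon>-parts are carried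
        along.\<close>
      define u u' where "u = monom (lead_coeff m) 0" and "u' = monom (coeff m' (degree m)) 0"
      define w w' where "w = monom (lead_coeff p) k" and "w' = monom (coeff q (degree p)) k"
      have uu: "(u, u') \<in> dual_polys G" and ww: "(w, w') \<in> dual_polys G"
        using mm' less.prems unfolding u_def u'_def w_def w'_def
        by (auto intro!: dual_polys_monom[OF G] simp: dual_polys_def dual_graph_zero[OF G])
      define r r' where "r = u * p - w * m" and "r' = (u' * p + u * q) - (w' * m + w * m')"
      have rr: "(r, r') \<in> dual_polys G"
        unfolding r_def r'_def
        by (intro dual_polys_diff dual_polys_mult G uu ww mm' less.prems)
      have ra: "poly r a = 0"
        using m less.prems by (simp add: r_def Q_def)
      have dle: "degree r \<le> degree p"
        unfolding r_def u_def w_def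
        by (intro degree_diff_le order.trans[OF degree_mult_le])
           (use le degree_monom_le[of "lead_coeff p" k] in \<open>auto simp: k_def monom_0\<close>)
      have "coeff r (degree p) = 0"
        using le by (simp add: r_def u_def w_def k_def monom_0 coeff_monom_mult)
      \<comment> \<open>If the degrees agreed, \<open>r\<close> would be 0 and so of degree 0, but
        \<open>degree p\<close> is at least \<open>degree m\<close>, which is positive.\<close>
      then have "degree r < degree p"
        using dle deg le leading_coeff_0_iff[of r] by (cases "degree r = degree p") auto
      from less.hyps[OF this rr ra] have "eps_part a b r r' = 0" .
      moreover have "eps_part a b r r' = lead_coeff m * eps_part a b p q"
        unfolding r_def r'_def eps_part_diff eps_part_mult
        using m0 m less.prems by (simp add: Q_def u_def poly_monom)
      moreover have "lead_coeff m \<noteq> 0" using m by (simp add: Q_def)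
      ultimately show ?thesis by simp
    qed
  qed
  then show ?thesis using dual_graph_adjoin[OF G] by blast
qed

text \<open>By Zorn's lemma there is a maximal graph above \<open>G\<close>. It has a value at every
  real, since a missing real could still be adjoined.\<close>

lemma dual_graph_extends_to_derivation:
  assumes G: "dual_graph G"
  shows "\<exists>D. derivation D \<and> (\<forall>a b. (a, b) \<in> G \<longrightarrow> D a = b)"
proof -
  define \<A> where "\<A> = {H. dual_graph H \<and> G \<subseteq> H}"
  have "\<exists>M\<in>\<A>. \<forall>X\<in>\<A>. M \<subseteq> X \<longrightarrow> X = M"
  proof (rule subset_Zorn_nonempty)
    show "\<A> \<noteq> {}" using G by (auto simp: \<A>_def)
  next
    fix \<C> assume ne: "\<C> \<noteq> {}" and ch: "subset.chain \<A> \<C>"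
    have C: "dual_graph H" "G \<subseteq> H" if "H \<in> \<C>" for H
      using that ch by (auto simp: subset.chain_def \<A>_def)
    have two: "\<exists>H\<in>\<C>. x \<in> H \<and> y \<in> H" if "x \<in> \<Union>\<C>" "y \<in> \<Union>\<C>" for x y
      using that ch unfolding subset_chain_def by blast
    have "dual_graph (\<Union>\<C>)"
      unfolding dual_graph_def
    proof (intro conjI allI impI)
      show "(1, 0) \<in> \<Union>\<C>" using ne C dual_graphD(1) by blast
      show "b = 0" if "(0, b) \<in> \<Union>\<C>" for b using that C dual_graphD(4) by blast
      fix a a' b b' assume ab: "(a, a') \<in> \<Union>\<C>" "(b, b') \<in> \<Union>\<C>"
      then obtain H where "H \<in> \<C>" "(a, a') \<in> H" "(b, b') \<in> H" using two by blast
      then show "(a - b, a' - b') \<in> \<Union>\<C>" "(a * b, a' * b + a * b') \<in> \<Union>\<C>"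
        using C(1) dual_graphD(2,3)[of H a a' b b'] by (meson UnionI)+
    qed
    then show "\<Union>\<C> \<in> \<A>" using ne C by (auto simp: \<A>_def)
  qed
  then obtain M where "M \<in> \<A>" and M': "\<forall>X\<in>\<A>. M \<subseteq> X \<longrightarrow> X = M" ..
  then have M: "dual_graph M" "G \<subseteq> M"
    by (simp_all add: \<A>_def)
  have max: "X = M" if "dual_graph X" "G \<subseteq> X" "M \<subseteq> X" for X
    using that M' by (simp add: \<A>_def)
  have "\<exists>b. (a, b) \<in> M" for a
  proof -
    obtain b where "dual_graph (dual_adjoin M a b)" using dual_graph_adjoin_exists[OF M(1)] by blast
    then have "dual_adjoin M a b = M" using dual_adjoin_superset(1)[OF M(1)] M(2) by (intro max) auto
    then show ?thesis using dual_adjoin_superset(2)[OF M(1)] by metis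
  qed
  then obtain D where D: "\<And>a. (a, D a) \<in> M" by metis
  have "derivation D"
    unfolding derivation_def
    using dual_graph_unique[OF M(1) D] dual_graph_add[OF M(1) D D] dual_graphD(3)[OF M(1) D D] by blast
  moreover have "D a = b" if "(a, b) \<in> G" for a b
    using dual_graph_unique[OF M(1) D] that M(2) by blast
  ultimately show ?thesis by blast
qed

section \<open>Algebraic independence and derivations with prescribed values\<close>

definition adjoin :: "real set \<Rightarrow> real \<Rightarrow> real set" where
  "adjoin R a = {poly p a | p. \<forall>n. coeff p n \<in> R}"

primrec tower :: "(nat \<Rightarrow> real) \<Rightarrow> nat \<Rightarrow> real set" where
  "tower x 0 = \<int>"
| "tower x (Suc k) = adjoin (tower x k) (x k)"

text \<open>Independence over the integers, stated one element at a time. Both uses want this form: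
  derivations are extended by one element after another, and the measure estimate varies one
  coordinate while the earlier ones stay fixed.\<close>

definition alg_independent :: "(nat \<Rightarrow> real) \<Rightarrow> nat \<Rightarrow> bool" where
  "alg_independent x n \<longleftrightarrow> (\<forall>k<n. transcendental_over (tower x k) (x k))"

lemma dual_adjoin_fst_subset: "fst ` dual_adjoin G a b \<subseteq> adjoin (fst ` G) a"
proof -
  have "\<exists>p'. poly p a = poly p' a \<and> (\<forall>n. coeff p' n \<in> fst ` G)"
    if "(p, q) \<in> dual_polys G" for p q
    using that by (intro exI[of _ p]) (force simp: dual_polys_def)
  then show ?thesis by (fastforce simp: dual_adjoin_def adjoin_def)
qed

lemma transcendental_over_mono:
  "R \<subseteq> S \<Longrightarrow> transcendental_over S a \<Longrightarrow> transcendental_over R a"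
  by (auto simp: transcendental_over_def)

lemma adjoin_mono: "R \<subseteq> S \<Longrightarrow> adjoin R a \<subseteq> adjoin S a"
  by (auto simp: adjoin_def)

text \<open>Start from the zero derivation on the integers and adjoin the \<open>x k\<close> in
  turn. It is enough to keep the domain inside the tower, because transcendence passes to smaller
  rings.\<close>

lemma alg_independent_derivation:
  assumes "alg_independent x n"
  shows "\<exists>D. derivation D \<and> (\<forall>k<n. D (x k) = b k)"
proof -
  have "\<exists>G. dual_graph G \<and> fst ` G \<subseteq> tower x n \<and> (\<forall>k<n. (x k, b k) \<in> G)"
    using assms
  proof (induction n)
    case 0
    have "dual_graph (\<int> \<times> {0})" by (auto simp: dual_graph_def)
    then show ?case by (intro exI[of _ "\<int> \<times> {0}"]) auto
  next
    case (Suc n)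
    then obtain G where G: "dual_graph G" "fst ` G \<subseteq> tower x n" "\<forall>k<n. (x k, b k) \<in> G"
      unfolding alg_independent_def by auto
    have "transcendental_over (fst ` G) (x n)"
      using Suc.prems transcendental_over_mono[OF G(2)] by (auto simp: alg_independent_def)
    then have "dual_graph (dual_adjoin G (x n) (b n))"
      by (rule dual_graph_adjoin_transcendental[OF G(1)])
    moreover have "fst ` dual_adjoin G (x n) (b n) \<subseteq> tower x (Suc n)"
      using dual_adjoin_fst_subset adjoin_mono[OF G(2)] by fastforce
    moreover have "\<forall>k<Suc n. (x k, b k) \<in> dual_adjoin G (x n) (b n)"
      using G(3) dual_adjoin_superset[OF G(1)] by (auto simp: less_Suc_eq)
    ultimately show ?case by blast
  qed
  then obtain G where G: "dual_graph G" "\<forall>k<n. (x k, b k) \<in> G" by blast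
  from dual_graph_extends_to_derivation[OF G(1)] G(2) show ?thesis by metis
qed

section \<open>Null sets\<close>

text \<open>By the Lindelof property countably many of the neighbourhoods suffice.\<close>

lemma negligible_if_locally:
  fixes S :: "'a::euclidean_space set"
  assumes "\<And>x. x \<in> S \<Longrightarrow> \<exists>W. open W \<and> x \<in> W \<and> negligible (S \<inter> W)"
  shows "negligible S"
proof -
  define \<F> where "\<F> = {W. open W \<and> negligible (S \<inter> W)}"
  obtain \<G> where \<G>: "\<G> \<subseteq> \<F>" "countable \<G>" "\<Union>\<G> = \<Union>\<F>"
    using Lindelof[of \<F>] by (auto simp: \<F>_def)
  have "negligible (\<Union>W\<in>\<G>. S \<inter> W)"
    using \<G> unfolding negligible_iff_null_sets
    by (intro null_sets_UN') (auto simp: \<F>_def negligible_iff_null_sets)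
  moreover have "S \<subseteq> (\<Union>W\<in>\<G>. S \<inter> W)"
    using assms \<G>(3) unfolding \<F>_def by fastforce
  ultimately show ?thesis by (rule negligible_subset)
qed

text \<open>Local injectivity is proved below from continuity of the derivative in operator norm,
  while charts provide continuity only for each fixed vector. In finite dimension the values on a
  basis bound the operator norm.\<close>

lemma onorm_continuous_if_pointwise:
  fixes f' :: "'a::euclidean_space \<Rightarrow> 'a \<Rightarrow> 'a"
  assumes U: "open U" "a \<in> U"
    and lin: "\<And>x. x \<in> U \<Longrightarrow> linear (f' x)"
    and cont: "\<And>v. continuous_on U (\<lambda>x. f' x v)"
    and e: "e > 0"
  shows "\<exists>d>0. \<forall>x. dist a x < d \<longrightarrow> x \<in> U \<and> onorm (\<lambda>v. f' x v - f' a v) < e"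
proof -
  define h where "h x = (\<Sum>b\<in>Basis. norm (f' x b - f' a b))" for x
  have "continuous_on U h" unfolding h_def by (intro continuous_intros cont)
  then have "isCont h a" using U continuous_on_eq_continuous_at by blast
  moreover have "h a = 0" by (simp add: h_def)
  ultimately have "\<forall>\<^sub>F x in at a. h x < e"
    using e unfolding isCont_def by (metis order_tendstoD(2))
  then have "\<forall>\<^sub>F x in nhds a. h x < e \<and> x \<in> U"
    using e \<open>h a = 0\<close> U by (auto simp: eventually_nhds_conv_at eventually_conj_iff
        intro: eventually_at_in_open' eventually_nhds_in_open)
  then obtain d where d: "d > 0" "\<And>x. dist x a < d \<Longrightarrow> h x < e \<and> x \<in> U"
    unfolding eventually_nhds_metric by blast
  have "onorm (\<lambda>v. f' x v - f' a v) \<le> h x" if "x \<in> U" for x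
  proof (rule onorm_bound)
    show "0 \<le> h x" by (simp add: h_def sum_nonneg)
    fix v
    have lin': "linear (\<lambda>v. f' x v - f' a v)" using lin that U by (intro linear_compose_sub)
    have "f' x v - f' a v = (\<Sum>b\<in>Basis. (v \<bullet> b) *\<^sub>R (f' x b - f' a b))"
      using linear_sum[OF lin', of "\<lambda>b. (v \<bullet> b) *\<^sub>R b" Basis] linear_scale[OF lin']
      by (simp add: euclidean_representation)
    also have "norm \<dots> \<le> (\<Sum>b\<in>Basis. norm (f' x b - f' a b) * norm v)"
      by (intro sum_norm_le) (simp add: Basis_le_norm mult.commute mult_right_mono)
    finally show "norm (f' x v - f' a v) \<le> h x * norm v"
      by (simp add: h_def sum_distrib_right)
  qed
  then show ?thesis using d by (metis dist_commute order_le_less_trans)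
qed

text \<open>Locally \<open>f\<close> has an inverse, and differentiable maps between spaces of equal
  dimension preserve null sets.\<close>

lemma negligible_preimage_immersion:
  fixes f :: "'a::euclidean_space \<Rightarrow> 'a"
  assumes U: "open U"
    and der: "\<And>x. x \<in> U \<Longrightarrow> (f has_derivative f' x) (at x)"
    and cont: "\<And>v. continuous_on U (\<lambda>x. f' x v)"
    and N: "negligible N"
  shows "negligible {x \<in> U. inj (f' x) \<and> f x \<in> N}" (is "negligible ?S")
proof (rule negligible_if_locally)
  fix a assume "a \<in> ?S"
  then have a: "a \<in> U" "inj (f' a)" by auto
  have lin: "linear (f' x)" if "x \<in> U" for x using der[OF that] has_derivative_linear by blast
  obtain g' where g': "linear g'" "g' \<circ> f' a = id"
    using linear_injective_left_inverse[OF lin] a by blast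
  have "\<exists>d>0. \<forall>x. dist a x < d \<longrightarrow> onorm (\<lambda>v. f' x v - f' a v) < e" if "e > 0" for e
    using onorm_continuous_if_pointwise[OF U a(1) lin cont that] by blast
  then obtain r where r: "r > 0" "ball a r \<subseteq> U" "inj_on f (ball a r)"
    using has_derivative_locally_injective[OF a(1) U _ g'(2) der] g'(1) linear_conv_bounded_linear
    by blast
  define g where "g = inv_into (ball a r) f"
  have gf: "g (f x) = x" if "x \<in> ball a r" for x
    unfolding g_def using r(3) that by simp
  \<comment> \<open>Claimed only at images of points of the set, where \<open>f' x\<close> is known
    to be invertible.\<close>
  have "g differentiable (at (f x))" if "x \<in> ?S \<inter> ball a r" for x
  proof -
    have x: "x \<in> U" "inj (f' x)" using that by auto
    obtain h where h: "linear h" "f' x \<circ> h = id"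
      using linear_surjective_right_inverse[OF lin] linear_injective_imp_surjective[OF lin] x by blast
    have "continuous_on (ball a r) f"
      using der r(2) by (meson continuous_at_imp_continuous_on has_derivative_continuous subsetD)
    then have "(g has_derivative h) (at (f x))"
      using has_derivative_inverse_strong[of "ball a r" x f g "f' x" h] that gf der[OF x(1)] h by auto
    then show ?thesis by (auto simp: differentiable_def)
  qed
  then have "g differentiable_on f ` (?S \<inter> ball a r)"
    by (auto simp: differentiable_on_def intro: differentiable_at_withinI)
  moreover have "negligible (f ` (?S \<inter> ball a r))"
    using N by (rule negligible_subset) auto
  ultimately have "negligible (g ` f ` (?S \<inter> ball a r))"
    using negligible_differentiable_image_negligible[OF order_refl] by blast
  moreover have "?S \<inter> ball a r \<subseteq> g ` f ` (?S \<inter> ball a r)"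
    using gf by force
  ultimately show "\<exists>W. open W \<and> a \<in> W \<and> negligible (?S \<inter> W)"
    using r(1) negligible_subset by (intro exI[of _ "ball a r"]) auto
qed

text \<open>Some partial derivative, in a direction \<open>b\<close>, is nonzero. Replacing the
  coordinate along \<open>b\<close> by \<open>g\<close> is then an immersion at that point, and it
  sends zeros of \<open>g\<close> into a hyperplane.\<close>

lemma negligible_regular_zero_set:
  fixes g :: "'a::euclidean_space \<Rightarrow> real"
  assumes U: "open U"
    and der: "\<And>x. x \<in> U \<Longrightarrow> (g has_derivative g' x) (at x)"
    and cont: "\<And>v. continuous_on U (\<lambda>x. g' x v)"
  shows "negligible {x \<in> U. g x = 0 \<and> (\<exists>v. g' x v \<noteq> 0)}"
proof -
  have lin: "linear (g' x)" if "x \<in> U" for x using der[OF that] has_derivative_linear by blast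
  define f where "f b x = x - (x \<bullet> b) *\<^sub>R b + g x *\<^sub>R b" for b x :: 'a
  define f' where "f' b x v = v - (v \<bullet> b) *\<^sub>R b + g' x v *\<^sub>R b" for b x v :: 'a
  have "negligible {x \<in> U. inj (f' b x) \<and> f b x \<in> {y. b \<bullet> y = 0}}" if "b \<in> Basis" for b
  proof (rule negligible_preimage_immersion[OF U])
    show "(f b has_derivative f' b x) (at x)" if "x \<in> U" for x
      unfolding f_def f'_def by (auto intro!: derivative_eq_intros der[OF that])
    show "continuous_on U (\<lambda>x. f' b x v)" for v
      unfolding f'_def by (intro continuous_intros cont)
    show "negligible {y. b \<bullet> y = 0}" using that by (intro negligible_hyperplane) auto
  qed
  then have "negligible (\<Union>b\<in>Basis. {x \<in> U. inj (f' b x) \<and> f b x \<in> {y. b \<bullet> y = 0}})"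
    by (intro negligible_Union) auto
  moreover have "{x \<in> U. g x = 0 \<and> (\<exists>v. g' x v \<noteq> 0)} \<subseteq>
     (\<Union>b\<in>Basis. {x \<in> U. inj (f' b x) \<and> f b x \<in> {y. b \<bullet> y = 0}})"
  proof clarify
    fix x v assume x: "x \<in> U" "g x = 0" "g' x v \<noteq> 0"
    have "\<exists>b\<in>Basis. g' x b \<noteq> 0"
    proof (rule ccontr)
      assume "\<not> ?thesis"
      then have "g' x v = 0"
        using linear_sum[OF lin[OF x(1)], of "\<lambda>b. (v \<bullet> b) *\<^sub>R b" Basis] linear_scale[OF lin[OF x(1)]]
        by (simp add: euclidean_representation)
      then show False using x by simp
    qed
    then obtain b where b: "b \<in> Basis" "g' x b \<noteq> 0" by blast
    have "linear (f' b x)"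
      unfolding f'_def using lin[OF x(1)]
      by (auto simp: linear_iff algebra_simps)
    moreover have "w = 0" if "f' b x w = 0" for w
    proof -
      have w: "w = (w \<bullet> b - g' x w) *\<^sub>R b" using that by (simp add: f'_def algebra_simps)
      have "f' b x w \<bullet> b = g' x w" using b by (simp add: f'_def algebra_simps)
      then have "g' x w = 0" using that by simp
      moreover have "g' x w = (w \<bullet> b - g' x w) * g' x b"
        using linear_scale[OF lin[OF x(1)]] w by (metis real_scaleR_def)
      ultimately have "w \<bullet> b = 0" using b by simp
      then show ?thesis using w \<open>g' x w = 0\<close> by simp
    qed
    ultimately have "inj (f' b x)" by (simp add: linear_injective_0)
    moreover have "b \<bullet> f b x = 0" using b x by (simp add: f_def algebra_simps inner_commute)
    ultimately show "x \<in> (\<Union>b\<in>Basis. {x \<in> U. inj (f' b x) \<and> f b x \<in> {y. b \<bullet> y = 0}})"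
      using b x by auto
  qed
  ultimately show ?thesis by (rule negligible_subset)
qed

text \<open>Compute the measure of \<open>{(z, t). 0 \<le> t \<le> 1 \<and> z + t *\<^sub>R v \<in> E}\<close> in both orders.\<close>

lemma null_sets_countable_on_lines:
  fixes E :: "'a::euclidean_space set"
  assumes E: "E \<in> sets borel" and lines: "\<And>z. countable {t. z + t *\<^sub>R v \<in> E}"
  shows "E \<in> null_sets lborel"
proof -
  let ?P = "(lborel :: 'a measure) \<Otimes>\<^sub>M (lborel :: real measure)"
  define X where "X = {(z, t). t \<in> {0..1::real} \<and> z + t *\<^sub>R v \<in> E}"
  have "(\<lambda>p :: 'a \<times> real. fst p + snd p *\<^sub>R v) \<in> borel_measurable borel"
    by (intro borel_measurable_continuous_onI continuous_intros)
  from measurable_sets[OF this E]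
  have m: "(\<lambda>p :: 'a \<times> real. fst p + snd p *\<^sub>R v) -` E \<in> sets borel"
    by simp
  have "(UNIV :: 'a set) \<times> {0..1::real} \<in> sets borel"
    by (intro borel_closed closed_Times) auto
  then have "(UNIV \<times> {0..1}) \<inter> ((\<lambda>p :: 'a \<times> real. fst p + snd p *\<^sub>R v) -` E) \<in> sets borel"
    using m by blast
  moreover have "X = (UNIV \<times> {0..1}) \<inter> ((\<lambda>p :: 'a \<times> real. fst p + snd p *\<^sub>R v) -` E)"
    by (auto simp: X_def)
  moreover have "sets ?P = sets borel" by (metis lborel_prod sets_lborel)
  ultimately have X: "X \<in> sets ?P" by simp
  have "emeasure ?P X = (\<integral>\<^sup>+z. emeasure lborel (Pair z -` X) \<partial>lborel)"
    using X by (rule lborel.emeasure_pair_measure_alt)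
  also have "\<dots> = (\<integral>\<^sup>+z. 0 \<partial>(lborel :: 'a measure))"
  proof (rule nn_integral_cong)
    fix z :: 'a
    have "countable (Pair z -` X)"
      using lines[of z] by (rule countable_subset[rotated]) (auto simp: X_def)
    then show "emeasure lborel (Pair z -` X) = 0"
      using countable_imp_null_set_lborel by blast
  qed
  finally have "0 = emeasure ?P X" by simp
  also have "\<dots> = (\<integral>\<^sup>+t. emeasure lborel ((\<lambda>z. (z, t)) -` X) \<partial>lborel)"
    using X by (rule lborel_pair.emeasure_pair_measure_alt2)
  also have "\<dots> = (\<integral>\<^sup>+t. emeasure lborel E * indicator {0..1} t \<partial>(lborel :: real measure))"
  proof (rule nn_integral_cong)
    fix t :: real
    have "(\<lambda>z. (z, t)) -` X = (if t \<in> {0..1} then (\<lambda>z. t *\<^sub>R v + z) -` E else {})"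
      by (auto simp: X_def add.commute)
    moreover have "emeasure lborel ((\<lambda>z. t *\<^sub>R v + z) -` E) = emeasure lborel E"
    proof -
      have "emeasure lborel E = emeasure (distr lborel borel ((+) (t *\<^sub>R v))) E"
        by (simp add: lborel_distr_plus)
      also have "\<dots> = emeasure lborel ((\<lambda>z. t *\<^sub>R v + z) -` E)"
        using E by (subst emeasure_distr) auto
      finally show ?thesis by simp
    qed
    ultimately show "emeasure lborel ((\<lambda>z. (z, t)) -` X) = emeasure lborel E * indicator {0..1} t"
      by (auto simp: indicator_def)
  qed
  also have "\<dots> = emeasure lborel E"
    by (simp add: nn_integral_cmult_indicator)
  finally show ?thesis using E by (auto intro: null_setsI)
qed

section \<open>Algebraically dependent tuples form a null set\<close>

primrec tower_functions :: "nat \<Rightarrow> ((nat \<Rightarrow> real) \<Rightarrow> real) set" where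
  "tower_functions 0 = range (\<lambda>m x. of_int m)"
| "tower_functions (Suc k) =
     (\<lambda>fs x. \<Sum>i<length fs. (fs ! i) x * x k ^ i) ` lists (tower_functions k)"

lemma countable_tower_functions: "countable (tower_functions k)"
proof (induction k)
  case 0
  show ?case unfolding tower_functions.simps by (intro countable_image countableI_type)
next
  case (Suc k)
  then have "countable (lists (tower_functions k))" by (rule countable_lists)
  then show ?case unfolding tower_functions.simps by (rule countable_image)
qed

lemma coeffs_in_tower_functions:
  assumes R: "R = (\<lambda>f. f x) ` F" and p: "\<forall>n. coeff p n \<in> R"
  shows "\<exists>fs\<in>lists F. length fs = Suc (degree p) \<and> (\<forall>i\<le>degree p. (fs ! i) x = coeff p i)"
proof -
  have "\<exists>g. g \<in> F \<and> g x = coeff p n" for n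
  proof -
    have "coeff p n \<in> (\<lambda>f. f x) ` F" using p by (simp add: R)
    then show ?thesis by (rule imageE) auto
  qed
  then obtain f where "\<forall>n. f n \<in> F \<and> f n x = coeff p n"
    using choice[of "\<lambda>n g. g \<in> F \<and> g x = coeff p n"] by auto
  then have f: "\<And>n. f n \<in> F" "\<And>n. f n x = coeff p n" by auto
  show ?thesis
    by (rule bexI[of _ "map f [0..<Suc (degree p)]"]) (auto simp: f nth_append simp del: upt_Suc)
qed

text \<open>The ring \<open>tower x k\<close> changes with \<open>x\<close>, but its elements are
  values at \<open>x\<close> of countably many functions chosen in advance, the integer polynomials
  in the first \<open>k\<close> variables. So dependence is a countable union of conditions on
  \<open>x\<close>.\<close>

lemma tower_eq: "tower x k = (\<lambda>f. f x) ` tower_functions k"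
proof (induction k)
  case 0
  then show ?case by (auto simp: Ints_def image_image)
next
  case (Suc k)
  \<comment> \<open>Coefficients beyond the end of the list \<open>fs\<close> are 0.\<close>
  have "0 \<in> tower x k" 
    by (induction k) (auto simp: adjoin_def intro!: exI[of _ 0])
  show ?case
  proof (intro equalityI subsetI)
    fix y assume "y \<in> tower x (Suc k)"
    then obtain p where p: "y = poly p (x k)" "\<forall>n. coeff p n \<in> tower x k"
      by (auto simp: adjoin_def)
    obtain fs where fs: "fs \<in> lists (tower_functions k)" "length fs = Suc (degree p)"
      "\<forall>i\<le>degree p. (fs ! i) x = coeff p i"
      using coeffs_in_tower_functions[OF Suc p(2)] by blast
    have "y = (\<Sum>i<length fs. (fs ! i) x * x k ^ i)"
      using fs by (simp add: p(1) poly_altdef lessThan_Suc_atMost)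
    then show "y \<in> (\<lambda>f. f x) ` tower_functions (Suc k)" using fs(1) by auto
  next
    fix y assume "y \<in> (\<lambda>f. f x) ` tower_functions (Suc k)"
    then obtain fs where fs: "fs \<in> lists (tower_functions k)"
      and y: "y = (\<Sum>i<length fs. (fs ! i) x * x k ^ i)" by auto
    define p where "p = (\<Sum>i<length fs. monom ((fs ! i) x) i)"
    have "coeff p n = (if n < length fs then (fs ! n) x else 0)" for n
      by (simp add: p_def coeff_sum)
    then have "\<forall>n. coeff p n \<in> tower x k"
      using fs Suc \<open>0 \<in> tower x k\<close> by (auto simp: in_lists_conv_set)
    moreover have "y = poly p (x k)" by (simp add: y p_def poly_sum poly_monom)
    ultimately show "y \<in> tower x (Suc k)" by (auto simp: adjoin_def)
  qed
qed

lemma tower_functions_cong: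
  "f \<in> tower_functions k \<Longrightarrow> (\<And>j. j < k \<Longrightarrow> x j = y j) \<Longrightarrow> f x = f y"
proof (induction k arbitrary: f)
  case (Suc k)
  then obtain fs where fs: "fs \<in> lists (tower_functions k)"
      "f = (\<lambda>x. \<Sum>i<length fs. (fs ! i) x * x k ^ i)" by auto
  then have "(fs ! i) x = (fs ! i) y" if "i < length fs" for i
    using Suc.IH[of "fs ! i"] Suc.prems(2) that by (auto simp: in_lists_conv_set)
  then show ?case using Suc.prems(2) by (auto simp: fs(2) intro!: sum.cong)
qed auto

text \<open>The sequences compared later come from \<open>(!)\<close> on lists of length 4, which is
  unspecified beyond the end.\<close>

lemma alg_independent_cong:
  assumes "\<And>k. k < n \<Longrightarrow> x k = y k"
  shows "alg_independent x n \<longleftrightarrow> alg_independent y n"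
proof -
  have "tower x k = tower y k" if "k < n" for k
    unfolding tower_eq using tower_functions_cong[of _ k x y] assms that by (auto intro!: image_cong)
  then show ?thesis using assms by (auto simp: alg_independent_def)
qed

lemma borel_measurable_tower_functions:
  assumes "\<And>j. (\<lambda>z. x z j) \<in> borel_measurable M" "f \<in> tower_functions k"
  shows "(\<lambda>z. f (x z)) \<in> borel_measurable M"
  using assms(2)
proof (induction k arbitrary: f)
  case (Suc k)
  then obtain fs where fs: "fs \<in> lists (tower_functions k)"
      "f = (\<lambda>x. \<Sum>i<length fs. (fs ! i) x * x k ^ i)" by auto
  then have "(\<lambda>z. (fs ! i) (x z)) \<in> borel_measurable M" if "i < length fs" for i
    using Suc.IH[of "fs ! i"] that by (auto simp: in_lists_conv_set)
  then show ?case unfolding fs(2) using assms(1) by measurable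
qed auto

lemma zero_set_measurable:
  fixes g :: "'a::euclidean_space \<Rightarrow> real"
  assumes "g \<in> borel_measurable borel"
  shows "{z. g z = 0} \<in> sets borel" "{z. g z \<noteq> 0} \<in> sets borel"
  using measurable_sets[OF assms, of "{0}"] measurable_sets[OF assms, of "- {0}"]
  by (simp_all add: vimage_def)

text \<open>A dependent point lies in some \<open>B k fs\<close>: the coefficients \<open>fs\<close>
  do not all vanish there, yet the polynomial they form has the \<open>k\<close>-th coordinate as a
  root. Moving along \<open>e k\<close> leaves the coefficients fixed, as they involve only earlier
  coordinates, so such a line meets \<open>B k fs\<close> in finitely many points.\<close>

lemma negligible_alg_dependent:
  fixes e :: "nat \<Rightarrow> 'a::euclidean_space"
  assumes "\<And>j k. j < n \<Longrightarrow> k < n \<Longrightarrow> e j \<bullet> e k = (if j = k then 1 else 0)"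
  shows "negligible {z. \<not> alg_independent (\<lambda>k. z \<bullet> e k) n}"
proof -
  define B where "B k fs = {z :: 'a. (\<exists>i<length fs. (fs ! i) (\<lambda>k. z \<bullet> e k) \<noteq> 0) \<and>
      (\<Sum>i<length fs. (fs ! i) (\<lambda>k. z \<bullet> e k) * (z \<bullet> e k) ^ i) = 0}" for k fs
  have "B k fs \<in> null_sets lborel" if k: "k < n" and fs: "fs \<in> lists (tower_functions k)" for k fs
  proof (rule null_sets_countable_on_lines)
    have [measurable]: "(\<lambda>z. (fs ! i) (\<lambda>k. z \<bullet> e k)) \<in> borel_measurable borel" if "i < length fs" for i
    proof -
      have "fs ! i \<in> tower_functions k" using fs that by (auto simp: in_lists_conv_set)
      then show ?thesis
        by (rule borel_measurable_tower_functions[where x = "\<lambda>z k. z \<bullet> e k", rotated]) simp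
    qed
    have "(\<lambda>z. \<Sum>i<length fs. (fs ! i) (\<lambda>k. z \<bullet> e k) * (z \<bullet> e k) ^ i) \<in> borel_measurable borel"
      by (intro borel_measurable_sum borel_measurable_times borel_measurable_power) auto
    then have "{z. (\<Sum>i<length fs. (fs ! i) (\<lambda>k. z \<bullet> e k) * (z \<bullet> e k) ^ i) = 0} \<in> sets borel"
      by (rule zero_set_measurable(1))
    moreover have "{z. (fs ! i) (\<lambda>k. z \<bullet> e k) \<noteq> 0} \<in> sets borel" if "i < length fs" for i
      using that by (intro zero_set_measurable(2)) measurable
    then have "(\<Union>i<length fs. {z. (fs ! i) (\<lambda>k. z \<bullet> e k) \<noteq> 0}) \<in> sets borel"
      by (intro sets.finite_UN) auto
    moreover have "B k fs = (\<Union>i<length fs. {z. (fs ! i) (\<lambda>k. z \<bullet> e k) \<noteq> 0}) \<inter>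
        {z. (\<Sum>i<length fs. (fs ! i) (\<lambda>k. z \<bullet> e k) * (z \<bullet> e k) ^ i) = 0}"
      by (auto simp: B_def)
    ultimately show "B k fs \<in> sets borel" by (simp only: sets.Int)
    fix z
    define c where "c i = (fs ! i) (\<lambda>k. z \<bullet> e k)" for i
    define p where "p = (\<Sum>i<length fs. monom (c i) i)"
    have "(fs ! i) (\<lambda>j. (z + t *\<^sub>R e k) \<bullet> e j) = c i" if "i < length fs" for i t
      unfolding c_def
    proof (rule tower_functions_cong[where f = "fs ! i" and k = k])
      show "fs ! i \<in> tower_functions k" using fs that by (auto simp: in_lists_conv_set)
      show "(z + t *\<^sub>R e k) \<bullet> e j = z \<bullet> e j" if "j < k" for j
        using assms[of k j] k that by (simp add: inner_simps)
    qed
    then have *: "{t. z + t *\<^sub>R e k \<in> B k fs} =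
      {t. (\<exists>i<length fs. c i \<noteq> 0) \<and> poly p (z \<bullet> e k + t) = 0}"
      using assms[OF k k] by (auto simp: B_def p_def poly_sum poly_monom inner_simps)
    show "countable {t. z + t *\<^sub>R e k \<in> B k fs}"
    proof (cases "\<exists>i<length fs. c i \<noteq> 0")
      case True
      then obtain i where "i < length fs" "c i \<noteq> 0" by blast
      then have "coeff p i \<noteq> 0" by (simp add: p_def coeff_sum)
      then have "p \<noteq> 0" by auto
      then have "finite {s. poly p s = 0}" by (rule poly_roots_finite)
      then have "finite ((\<lambda>t. z \<bullet> e k + t) -` {s. poly p s = 0})"
        by (rule finite_vimageI) (simp add: inj_def)
      then show ?thesis unfolding * by (auto intro: countable_finite finite_subset)
    next
      case False
      then have "{t. z + t *\<^sub>R e k \<in> B k fs} = {}" unfolding * by blast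
      then show ?thesis by simp
    qed
  qed
  then have "negligible (B k fs)" if "k < n" "fs \<in> lists (tower_functions k)" for k fs
    using that by (simp add: negligible_iff_null_sets null_sets_completionI)
  then have "negligible (\<Union>k<n. \<Union>fs\<in>lists (tower_functions k). B k fs)"
    unfolding negligible_iff_null_sets
    by (intro null_sets_UN' countable_lists countable_tower_functions) auto
  moreover have "{z. \<not> alg_independent (\<lambda>k. z \<bullet> e k) n} \<subseteq>
      (\<Union>k<n. \<Union>fs\<in>lists (tower_functions k). B k fs)"
  proof
    fix z assume "z \<in> {z. \<not> alg_independent (\<lambda>k. z \<bullet> e k) n}"
    then obtain k p where k: "k < n" and p: "\<forall>i. coeff p i \<in> tower (\<lambda>k. z \<bullet> e k) k"
      "poly p (z \<bullet> e k) = 0" "p \<noteq> 0"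
      by (auto simp: alg_independent_def transcendental_over_def)
    obtain fs where fs: "fs \<in> lists (tower_functions k)" "length fs = Suc (degree p)"
      "\<forall>i\<le>degree p. (fs ! i) (\<lambda>k. z \<bullet> e k) = coeff p i"
      using coeffs_in_tower_functions[OF tower_eq p(1)] by blast
    have "z \<in> B k fs"
      using fs p by (auto simp: B_def poly_altdef lessThan_Suc_atMost intro!: exI[of _ "degree p"])
    then show "z \<in> (\<Union>k<n. \<Union>fs\<in>lists (tower_functions k). B k fs)" using k fs(1) by blast
  qed
  ultimately show ?thesis by (rule negligible_subset)
qed

section \<open>The 2-form of a polygon\<close>

text \<open>The product of two determinants is the determinant of the matrix of inner products.
  Multiplying by a triple product thus turns the edge forms, for which there is no direct formula,
  into inner products.\<close>

lemma triple_product_mult: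
  fixes a b c x y z :: "real^3"
  shows "(x \<bullet> cross3 y z) * (a \<bullet> cross3 b c) =
    x \<bullet> a * (y \<bullet> b * (z \<bullet> c) - y \<bullet> c * (z \<bullet> b)) - x \<bullet> b * (y \<bullet> a * (z \<bullet> c) - y \<bullet> c * (z \<bullet> a)) +
    x \<bullet> c * (y \<bullet> a * (z \<bullet> b) - y \<bullet> b * (z \<bullet> a))"
  by (simp add: cross3_simps)

lemma eq_if_inner_eq_basis:
  fixes e1 e2 e3 v w :: "real^3"
  assumes "e1 \<bullet> cross3 e2 e3 \<noteq> 0" "v \<bullet> e1 = w \<bullet> e1" "v \<bullet> e2 = w \<bullet> e2" "v \<bullet> e3 = w \<bullet> e3"
  shows "v = w"
proof -
  \<comment> \<open>The expansion of \<open>v - w\<close> in the dual basis, with the denominator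
    cleared.\<close>
  have "(e1 \<bullet> cross3 e2 e3) *\<^sub>R (v - w) =
     ((v - w) \<bullet> e1) *\<^sub>R cross3 e2 e3 + ((v - w) \<bullet> e2) *\<^sub>R cross3 e3 e1 + ((v - w) \<bullet> e3) *\<^sub>R cross3 e1 e2"
    by (simp add: cross3_simps forall_3)
  then show ?thesis using assms by (simp add: inner_diff_left)
qed

text \<open>The axis is \<open>a = \<Sum> (a \<bullet> e\<^sub>i\<^sup>*) e\<^sub>i\<close> with the dual basis \<open>e\<^sub>i\<^sup>* = e\<^sub>j \<times> e\<^sub>k / det\<close>, and
  \<open>a \<bullet> (e\<^sub>j \<times> e\<^sub>k) = (a \<times> e\<^sub>j) \<bullet> e\<^sub>k\<close>.\<close>

lemma infinitesimal_rotation_3: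
  fixes e1 e2 e3 u1 u2 u3 :: "real^3"
  assumes "e1 \<bullet> cross3 e2 e3 \<noteq> 0"
    and "u1 \<bullet> e1 = 0" "u2 \<bullet> e2 = 0" "u3 \<bullet> e3 = 0"
    and "u1 \<bullet> e2 + u2 \<bullet> e1 = 0" "u2 \<bullet> e3 + u3 \<bullet> e2 = 0" "u1 \<bullet> e3 + u3 \<bullet> e1 = 0"
  shows "\<exists>a. u1 = cross3 a e1 \<and> u2 = cross3 a e2 \<and> u3 = cross3 a e3"
proof -
  define d where "d = e1 \<bullet> cross3 e2 e3"
  define a where "a = (1 / d) *\<^sub>R ((u2 \<bullet> e3) *\<^sub>R e1 + (u3 \<bullet> e1) *\<^sub>R e2 + (u1 \<bullet> e2) *\<^sub>R e3)"
  have d: "d \<noteq> 0" using assms by (simp add: d_def)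
  have c: "e2 \<bullet> cross3 e3 e1 = d" "e3 \<bullet> cross3 e1 e2 = d"
    by (simp_all add: d_def cross3_simps)
  have z: "e1 \<bullet> cross3 e1 e2 = 0" "e2 \<bullet> cross3 e1 e2 = 0" "e2 \<bullet> cross3 e2 e3 = 0"
    "e3 \<bullet> cross3 e2 e3 = 0" "e1 \<bullet> cross3 e3 e1 = 0" "e3 \<bullet> cross3 e3 e1 = 0"
    by (simp_all add: dot_cross_self)
  have s: "a \<bullet> cross3 e1 e2 = u1 \<bullet> e2" "a \<bullet> cross3 e2 e3 = u2 \<bullet> e3" "a \<bullet> cross3 e3 e1 = u3 \<bullet> e1"
    using d c z by (simp_all add: a_def inner_add_left d_def[symmetric])
  have p: "cross3 a x \<bullet> y = a \<bullet> cross3 x y" "cross3 a x \<bullet> y = - (a \<bullet> cross3 y x)" for x y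
    by (simp_all add: cross3_simps)
  have "u1 = cross3 a e1"
    by (rule eq_if_inner_eq_basis[OF assms(1)]) (use s assms p(1)[of e1 e2] p(2)[of e1 e3] in \<open>simp_all add: dot_cross_self\<close>)
  moreover have "u2 = cross3 a e2"
    by (rule eq_if_inner_eq_basis[OF assms(1)]) (use s assms p(1)[of e2 e3] p(2)[of e2 e1] in \<open>simp_all add: dot_cross_self\<close>)
  moreover have "u3 = cross3 a e3"
    by (rule eq_if_inner_eq_basis[OF assms(1)]) (use s assms p(1)[of e3 e1] p(2)[of e3 e2] in \<open>simp_all add: dot_cross_self\<close>)
  ultimately show ?thesis by blast
qed

text \<open>Complete the pair by its normal \<open>cross3 e1 e2\<close>, whose velocity
  \<open>w\<close> is dictated by the product rule. The conditions involving the normal then follow,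
  and the case of three vectors applies.\<close>

lemma infinitesimal_rotation_2:
  fixes e1 e2 u1 u2 :: "real^3"
  assumes "cross3 e1 e2 \<noteq> 0" "u1 \<bullet> e1 = 0" "u2 \<bullet> e2 = 0" "u1 \<bullet> e2 + u2 \<bullet> e1 = 0"
  shows "\<exists>a. u1 = cross3 a e1 \<and> u2 = cross3 a e2"
proof -
  define n where "n = cross3 e1 e2"
  define w where "w = cross3 u1 e2 + cross3 e1 u2"
  have "e1 \<bullet> cross3 e2 n = n \<bullet> n" by (simp add: n_def cross3_simps)
  then have "e1 \<bullet> cross3 e2 n \<noteq> 0" using assms by (simp add: n_def)
  moreover have "w \<bullet> n = (u1 \<bullet> e1) * (e2 \<bullet> e2) + (e1 \<bullet> e1) * (u2 \<bullet> e2) - (e1 \<bullet> e2) * (u1 \<bullet> e2 + u2 \<bullet> e1)"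
    by (simp add: n_def w_def cross3_simps)
  then have "w \<bullet> n = 0" using assms by simp
  moreover have "u2 \<bullet> n + w \<bullet> e2 = 0" "u1 \<bullet> n + w \<bullet> e1 = 0"
    by (simp_all add: n_def w_def cross3_simps)
  ultimately show ?thesis using infinitesimal_rotation_3[of e1 e2 n u1 u2 w] assms by blast
qed

section \<open>Derivations acting on vectors and polygons\<close>

lemma derivation_simps:
  assumes "derivation D"
  shows "D (x + y) = D x + D y" "D (x * y) = D x * y + x * D y" "D 0 = 0" "D 1 = 0"
    "D (- x) = - D x" "D (x - y) = D x - D y"
proof -
  have add: "D (x + y) = D x + D y" and mult: "D (x * y) = D x * y + x * D y" for x y
    using assms by (auto simp: derivation_def)
  show "D (x + y) = D x + D y" "D (x * y) = D x * y + x * D y" by (fact add, fact mult)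
  show z: "D 0 = 0" using add[of 0 0] by simp
  show "D 1 = 0" using mult[of 1 1] by simp
  show m: "D (- x) = - D x" for x using add[of x "- x"] z by simp
  show "D (x - y) = D x - D y" using add[of x "- y"] m by simp
qed

definition vec_derivation :: "(real \<Rightarrow> real) \<Rightarrow> real^3 \<Rightarrow> real^3" where
  "vec_derivation D v = (\<chi> i. D (v $ i))"

lemma vec_derivation_simps:
  assumes "derivation D"
  shows "vec_derivation D (v + w) = vec_derivation D v + vec_derivation D w"
    "vec_derivation D (v - w) = vec_derivation D v - vec_derivation D w"
    "vec_derivation D (- v) = - vec_derivation D v"
    "D (v \<bullet> w) = vec_derivation D v \<bullet> w + vec_derivation D w \<bullet> v"
  by (simp_all add: vec_derivation_def vec_eq_iff derivation_simps[OF assms] inner_vec_def sum_3 algebra_simps)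

lemma vec_derivation_unit:
  assumes "derivation D" "v \<bullet> v = 1"
  shows "vec_derivation D v \<bullet> v = 0"
  using vec_derivation_simps(4)[OF assms(1), of v v] derivation_simps(4)[OF assms(1)] assms(2) by simp

text \<open>Evaluating differentials at two derivations of the field of real numbers, this is the
  symplectic form of the unit sphere at the edge \<open>e\<close>; summed over the edges of a closed polygon it
  is the Kapovich--Millson form of the polygon space.\<close>

definition edge_form :: "(real \<Rightarrow> real) \<Rightarrow> (real \<Rightarrow> real) \<Rightarrow> real^3 \<Rightarrow> real" where
  "edge_form D D' e = e \<bullet> cross3 (vec_derivation D e) (vec_derivation D' e)"

definition polygon_form :: "(real \<Rightarrow> real) \<Rightarrow> (real \<Rightarrow> real) \<Rightarrow> (real^3) list \<Rightarrow> real" where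
  "polygon_form D D' v = (\<Sum>(a, b)\<leftarrow>sides v. edge_form D D' (b - a))"

lemma edge_form_minus:
  assumes "derivation D" "derivation D'"
  shows "edge_form D D' (- e) = - edge_form D D' e"
  using assms by (simp add: edge_form_def vec_derivation_simps)

lemma edge_form_swap:
  assumes "derivation D" "derivation D'"
  shows "edge_form D D' (a - b) = - edge_form D D' (b - a)"
  using edge_form_minus[OF assms, of "b - a"] by simp

lemma sides_3: "sides [a, b, c] = [(a, b), (b, c), (c, a)]"
  by (simp add: sides_def upt_rec)

lemma sides_4: "sides [a, b, c, d] = [(a, b), (b, c), (c, d), (d, a)]"
  by (simp add: sides_def upt_rec)

lemma length_3E:
  assumes "length w = 3"
  obtains a b c where "w = [a, b, c]"
  using assms by (auto simp: numeral_eq_Suc length_Suc_conv)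

lemma length_4E:
  assumes "length w = 4"
  obtains a b c d where "w = [a, b, c, d]"
  using assms by (auto simp: numeral_eq_Suc length_Suc_conv)

lemma sides_map: "sides (map f w) = map (map_prod f f) (sides w)"
  by (auto simp: sides_def intro!: nth_map mod_less_divisor)

text \<open>The two lists differ in order, so they are compared as multisets. Only triangles and
  rhombi occur, and these are checked by inspection.\<close>

lemma mset_sides_rev:
  assumes "length w \<in> {3, 4}"
  shows "mset (sides (rev w)) = mset (map prod.swap (sides w))"
proof -
  consider "length w = 3" | "length w = 4" using assms by auto
  then show ?thesis
  proof cases
    case 1
    then obtain a b c where "w = [a, b, c]" by (rule length_3E)
    then show ?thesis by (simp add: sides_3)
  next
    case 2
    then obtain a b c d where "w = [a, b, c, d]" by (rule length_4E)
    then show ?thesis by (simp add: sides_4)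
  qed
qed

lemma sum_list_map_mset_cong:
  fixes \<phi> :: "'a \<Rightarrow> 'b::comm_monoid_add"
  shows "mset xs = mset ys \<Longrightarrow> (\<Sum>x\<leftarrow>xs. \<phi> x) = (\<Sum>x\<leftarrow>ys. \<phi> x)"
  by (metis mset_map sum_mset_sum_list)

lemma polygon_form_rev:
  assumes "derivation D" "derivation D'" "length v \<in> {3, 4}"
  shows "polygon_form D D' (rev v) = - polygon_form D D' v"
proof -
  have "polygon_form D D' (rev v) = (\<Sum>(a, b)\<leftarrow>map prod.swap (sides v). edge_form D D' (b - a))"
    unfolding polygon_form_def by (rule sum_list_map_mset_cong[OF mset_sides_rev[OF assms(3)]])
  also have "\<dots> = (\<Sum>(a, b)\<leftarrow>sides v. - edge_form D D' (b - a))"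
    unfolding map_map
    by (intro arg_cong[where f = sum_list] map_cong refl) (clarsimp, rule edge_form_swap[OF assms(1,2)])
  also have "\<dots> = - polygon_form D D' v"
    by (simp add: polygon_form_def uminus_sum_list_map o_def case_prod_unfold)
  finally show ?thesis .
qed

text \<open>Let \<open>D\<close> and \<open>D'\<close> act on the edges as rotations about axes
  \<open>x\<close> and \<open>y\<close>. Then the form of a unit edge \<open>v\<close> is
  \<open>v \<bullet> cross3 x y\<close>, which is linear in \<open>v\<close>, and the edges of a
  triangle add up to 0.\<close>

lemma triangle_form_zero:
  assumes D: "derivation D" "derivation D'"
    and "dist a b = 1" "dist b c = 1" "dist c a = 1"
  shows "polygon_form D D' [a, b, c] = 0"
proof -
  define e f where "e = b - a" and "f = c - b"
  have g: "a - c = - (e + f)" by (simp add: e_def f_def)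
  have ee: "e \<bullet> e = 1" and ff: "f \<bullet> f = 1" and "(e + f) \<bullet> (e + f) = 1"
    using assms(3-5) by (simp_all add: e_def f_def dist_norm norm_eq_1 norm_minus_commute[of a b] norm_minus_commute[of b c])
  then have ef: "e \<bullet> f = - 1 / 2" by (simp add: inner_simps inner_commute)
  have "cross3 e f \<bullet> cross3 e f = (e \<bullet> e) * (f \<bullet> f) - (e \<bullet> f) * (e \<bullet> f)"
    by (simp add: cross3_simps)
  then have n: "cross3 e f \<noteq> 0" unfolding ee ff ef by auto
  have rot: "\<exists>x. vec_derivation D e = cross3 x e \<and> vec_derivation D f = cross3 x f" if "derivation D" for D
  proof (rule infinitesimal_rotation_2[OF n])
    show "vec_derivation D e \<bullet> e = 0" "vec_derivation D f \<bullet> f = 0"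
      using that ee ff by (simp_all add: vec_derivation_unit)
    have "D 2 = 0" using derivation_simps[OF that] by (metis add_cancel_right_right one_add_one)
    moreover have "D (2 * (e \<bullet> f)) = D (- 1)" using ef by simp
    ultimately have "D (e \<bullet> f) = 0"
      using derivation_simps[OF that] by simp
    then show "vec_derivation D e \<bullet> f + vec_derivation D f \<bullet> e = 0"
      using vec_derivation_simps(4)[OF that] by simp
  qed
  obtain x where x: "vec_derivation D e = cross3 x e" "vec_derivation D f = cross3 x f" using rot[OF D(1)] by blast
  obtain y where y: "vec_derivation D' e = cross3 y e" "vec_derivation D' f = cross3 y f" using rot[OF D(2)] by blast
  have r: "v \<bullet> cross3 (cross3 x v) (cross3 y v) = (v \<bullet> v) * (v \<bullet> cross3 x y)" for v
    by (simp add: cross3_simps)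
  have "edge_form D D' e = e \<bullet> cross3 x y" "edge_form D D' f = f \<bullet> cross3 x y"
    using ee ff by (simp_all add: edge_form_def x y r)
  moreover have "edge_form D D' (e + f) = (e + f) \<bullet> cross3 x y"
    using \<open>(e + f) \<bullet> (e + f) = 1\<close> r[of "e + f"]
    by (simp add: edge_form_def vec_derivation_simps D x y cross_add_right)
  ultimately show ?thesis
    using edge_form_minus[OF D, of "e + f"]
    by (simp add: polygon_form_def sides_3 g e_def[symmetric] f_def[symmetric] inner_add_left)
qed

section \<open>Cancellation over a closed oriented surface\<close>

lemma sum_sides_closed_surface:
  fixes \<phi> :: "'a \<times> 'a \<Rightarrow> real"
  assumes cs: "closed_surface Fs" and len: "\<And>F. F \<in> set Fs \<Longrightarrow> length F \<in> {3, 4}"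
    and Gs: "list_all2 (\<lambda>F G. G = F \<or> G = rev F) Fs Gs" "distinct (concat (map sides Gs))"
    and anti: "\<And>a b. \<phi> (b, a) = - \<phi> (a, b)"
  shows "(\<Sum>s\<leftarrow>concat (map sides Gs). \<phi> s) = 0"
proof -
  define h where "h = (\<lambda>(a :: 'a, b). {a, b})"
  define L where "L = concat (map sides Gs)"
  have hs: "h (prod.swap p) = h p" for p by (auto simp: h_def case_prod_beta)
  have "mset (edges Fs) = mset (map h L)"
    using Gs(1) len unfolding edges_def h_def[symmetric] L_def
  proof (induction rule: list_all2_induct)
    case (Cons F Fs G Gs)
    have "mset (map h (sides (rev F))) = mset (map h (sides F))"
      using arg_cong[OF mset_sides_rev[of F], of "image_mset h"] Cons.prems
      by (simp add: image_mset.compositionality o_def hs)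
    then show ?case using Cons by auto
  qed simp
  then have count: "count_list (edges Fs) e = count_list (map h L) e"
    and set: "set (edges Fs) = set (map h L)" for e
    by (metis count_mset, metis set_mset_mset)
  \<comment> \<open>The edge occurs twice among the sides, and no directed side is repeated, so its
    two occurrences are opposite.\<close>
  have swap: "(b, a) \<in> set L" if "(a, b) \<in> set L" for a b
  proof (rule ccontr)
    assume n: "(b, a) \<notin> set L"
    have "{a, b} \<in> set (edges Fs)" unfolding set using that by (force simp: h_def)
    then have "count_list (map h L) {a, b} = 2"
      using cs count by (simp add: closed_surface_def)
    moreover have "count_list (map h L) {a, b} = card {p \<in> set L. h p = {a, b}}"
    proof -
      have "count_list (map h L) {a, b} = length (filter (\<lambda>p. h p = {a, b}) L)"
        by (induction L) auto
      also have "\<dots> = card (set (filter (\<lambda>p. h p = {a, b}) L))"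
        using Gs(2) distinct_card[OF distinct_filter, of L] unfolding L_def[symmetric] by simp
      finally show ?thesis by simp
    qed
    moreover have "{p \<in> set L. h p = {a, b}} \<subseteq> {(a, b)}"
    proof
      fix p assume p: "p \<in> {p \<in> set L. h p = {a, b}}"
      then have "p = (a, b) \<or> p = (b, a)" by (cases p) (simp add: h_def doubleton_eq_iff)
      then show "p \<in> {(a, b)}" using p n by auto
    qed
    then have "card {p \<in> set L. h p = {a, b}} \<le> card {(a, b)}"
      by (intro card_mono) auto
    ultimately show False by simp
  qed
  \<comment> \<open>Hence the sum equals its own negative.\<close>
  have "prod.swap ` set L = set L"
  proof
    show "prod.swap ` set L \<subseteq> set L" using swap by auto
    show "set L \<subseteq> prod.swap ` set L"
    proof
      fix p assume "p \<in> set L"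
      then have "prod.swap p \<in> set L" using swap[of "fst p" "snd p"] by (simp add: prod.swap_def)
      then show "p \<in> prod.swap ` set L" by (rule rev_image_eqI) simp
    qed
  qed
  moreover have "sum \<phi> (prod.swap ` set L) = (\<Sum>p\<in>set L. \<phi> (prod.swap p))"
    by (rule sum.reindex_cong[where l = prod.swap]) auto
  ultimately have "sum \<phi> (set L) = (\<Sum>p\<in>set L. \<phi> (prod.swap p))" by simp
  also have "\<dots> = (\<Sum>p\<in>set L. - \<phi> p)"
  proof (rule sum.cong)
    show "\<phi> (prod.swap p) = - \<phi> p" for p using anti[of "snd p" "fst p"] by (simp add: prod.swap_def)
  qed simp
  also have "\<dots> = - sum \<phi> (set L)" by (rule sum_negf)
  finally have "sum \<phi> (set L) = 0" by simp
  then show ?thesis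
    using Gs(2) unfolding L_def[symmetric] by (simp add: sum_list_distinct_conv_sum_set)
qed

lemma sum_list_concat_map:
  fixes g :: "'a \<Rightarrow> 'b::comm_monoid_add"
  shows "sum_list (map g (concat xss)) = (\<Sum>xs\<leftarrow>xss. sum_list (map g xs))"
  by (induction xss) auto

lemma polygon_form_map:
  "polygon_form D D' (map f w) = (\<Sum>(a, b)\<leftarrow>sides w. edge_form D D' (f b - f a))"
  by (simp add: polygon_form_def sides_map o_def case_prod_unfold)

text \<open>The signs tell which boundary walks the orientation reverses. They come from the dome
  alone and are therefore chosen before \<open>D\<close> and \<open>D'\<close>; later the relation
  is combined for several pairs of derivations with the same signs.\<close>

lemma cobordant_forms:
  assumes "orientably_cobordant \<rho>\<^sub>1 \<rho>\<^sub>2 \<rho>\<^sub>3" and len: "length \<rho>\<^sub>1 = 4" "length \<rho>\<^sub>2 = 4" "length \<rho>\<^sub>3 = 4"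
  shows "\<exists>s1 s2 s3 :: real. s1\<^sup>2 = 1 \<and> s2\<^sup>2 = 1 \<and> s3\<^sup>2 = 1 \<and>
    (\<forall>D D'. derivation D \<longrightarrow> derivation D' \<longrightarrow>
      s1 * polygon_form D D' \<rho>\<^sub>1 + s2 * polygon_form D D' \<rho>\<^sub>2 + s3 * polygon_form D D' \<rho>\<^sub>3 = 0)"
proof -
  obtain Ts ws f where dome: "orientable_dome Ts ws f [\<rho>\<^sub>1, \<rho>\<^sub>2, \<rho>\<^sub>3]"
    using assms unfolding orientably_cobordant_def by blast
  then have T3: "\<And>t. t \<in> set Ts \<Longrightarrow> length t = 3" and cs: "closed_surface (Ts @ ws)"
    and ori: "orientable (Ts @ ws)"
    and unit: "\<And>a b. {a, b} \<in> set (edges (Ts @ ws)) \<Longrightarrow> dist (f a) (f b) = 1"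
    and "map (map f) ws = [\<rho>\<^sub>1, \<rho>\<^sub>2, \<rho>\<^sub>3]"
    unfolding orientable_dome_def by blast+
  then obtain w1 w2 w3 where ws: "ws = [w1, w2, w3]" "map f w1 = \<rho>\<^sub>1" "map f w2 = \<rho>\<^sub>2" "map f w3 = \<rho>\<^sub>3"
    by (auto simp: map_eq_Cons_conv)
  have w4: "length w1 = 4" "length w2 = 4" "length w3 = 4" using ws len by auto
  obtain Gs where Gs: "list_all2 (\<lambda>F G. G = F \<or> G = rev F) (Ts @ ws) Gs" "distinct (concat (map sides Gs))"
    using ori unfolding orientable_def by blast
  then obtain Hs G1 G2 G3 where H: "Gs = Hs @ [G1, G2, G3]"
    "list_all2 (\<lambda>F G. G = F \<or> G = rev F) Ts Hs"
    "G1 = w1 \<or> G1 = rev w1" "G2 = w2 \<or> G2 = rev w2" "G3 = w3 \<or> G3 = rev w3"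
    unfolding ws(1) by (auto simp: list_all2_append1 list_all2_Cons1)
  have tri: "polygon_form D D' (map f G) = 0"
    if D: "derivation D" "derivation D'" and G: "G \<in> set Hs" for D D' G
  proof -
    obtain t where t: "t \<in> set Ts" "G = t \<or> G = rev t"
      using H(2) G unfolding list_all2_conv_all_nth in_set_conv_nth by metis
    obtain a b c where abc: "t = [a, b, c]" using T3[OF t(1)] by (rule length_3E)
    have "{{a, b}, {b, c}, {c, a}} \<subseteq> set (edges (Ts @ ws))"
      using t(1) by (force simp: edges_def abc sides_3)
    then have "polygon_form D D' (map f t) = 0"
      using triangle_form_zero[OF D] unit by (simp add: abc)
    then show ?thesis
      using t(2) polygon_form_rev[OF D, of "map f t"] by (auto simp: rev_map abc)
  qed
  have sum0: "polygon_form D D' (map f G1) + polygon_form D D' (map f G2) + polygon_form D D' (map f G3) = 0"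
    if D: "derivation D" "derivation D'" for D D'
  proof -
    have "(\<Sum>(a, b)\<leftarrow>concat (map sides Gs). edge_form D D' (f b - f a)) = 0"
    proof (rule sum_sides_closed_surface[OF cs _ Gs])
      show "length F \<in> {3, 4}" if "F \<in> set (Ts @ ws)" for F
        using that T3 w4 by (auto simp: ws(1))
    qed (simp, rule edge_form_swap[OF D])
    then have "(\<Sum>G\<leftarrow>Gs. polygon_form D D' (map f G)) = 0"
      by (simp add: sum_list_concat_map polygon_form_map o_def)
    moreover have "(\<Sum>G\<leftarrow>Hs. polygon_form D D' (map f G)) = 0"
      using tri[OF D] by (simp add: sum_list_0 cong: map_cong)
    ultimately show ?thesis by (simp add: H(1) add.assoc)
  qed
  have sgn: "\<exists>s::real. s\<^sup>2 = 1 \<and> (\<forall>D D'. derivation D \<longrightarrow> derivation D' \<longrightarrow>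
      polygon_form D D' (map f G) = s * polygon_form D D' (map f w))"
    if "G = w \<or> G = rev w" "length w = 4" for G w
    using that(1)
  proof
    assume "G = w"
    then show ?thesis by (intro exI[of _ 1]) simp
  next
    assume "G = rev w"
    then show ?thesis using polygon_form_rev[of _ _ "map f w"] that(2)
      by (intro exI[of _ "-1"]) (simp add: rev_map)
  qed
  obtain s1 where s1: "s1\<^sup>2 = 1" "\<And>D D'. derivation D \<Longrightarrow> derivation D' \<Longrightarrow>
      polygon_form D D' (map f G1) = s1 * polygon_form D D' \<rho>\<^sub>1"
    using sgn[OF H(3) w4(1)] unfolding ws(2) by blast
  obtain s2 where s2: "s2\<^sup>2 = 1" "\<And>D D'. derivation D \<Longrightarrow> derivation D' \<Longrightarrow>
      polygon_form D D' (map f G2) = s2 * polygon_form D D' \<rho>\<^sub>2"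
    using sgn[OF H(4) w4(2)] unfolding ws(3) by blast
  obtain s3 where s3: "s3\<^sup>2 = 1" "\<And>D D'. derivation D \<Longrightarrow> derivation D' \<Longrightarrow>
      polygon_form D D' (map f G3) = s3 * polygon_form D D' \<rho>\<^sub>3"
    using sgn[OF H(5) w4(3)] unfolding ws(4) by blast
  have "s1 * polygon_form D D' \<rho>\<^sub>1 + s2 * polygon_form D D' \<rho>\<^sub>2 + s3 * polygon_form D D' \<rho>\<^sub>3 = 0"
    if "derivation D" "derivation D'" for D D'
    using sum0[OF that] unfolding s1(2)[OF that] s2(2)[OF that] s3(2)[OF that] .
  then show ?thesis using s1(1) s2(1) s3(1) by blast
qed

section \<open>The form of a rhombus in terms of two cosines\<close>

definition side :: "(real^3) list \<Rightarrow> nat \<Rightarrow> real^3" where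
  "side v i = v ! (Suc i mod 4) - v ! i"

definition cos_1 :: "(real^3) list \<Rightarrow> real" where
  "cos_1 v = side v 0 \<bullet> side v 1"

definition cos_2 :: "(real^3) list \<Rightarrow> real" where
  "cos_2 v = side v 1 \<bullet> side v 2"

text \<open>The signed volume spanned by three consecutive sides, which is 0 exactly for planar
  rhombi.\<close>

definition spat :: "(real^3) list \<Rightarrow> real" where
  "spat v = side v 0 \<bullet> cross3 (side v 1) (side v 2)"

lemma Suc_mod_4:
  "Suc 0 mod 4 = 1" "Suc 1 mod 4 = 2" "Suc 2 mod 4 = 3" "Suc 3 mod 4 = 0"
  by simp_all

lemma less_4_cases: "(i :: nat) < 4 \<Longrightarrow> i = 0 \<or> i = 1 \<or> i = 2 \<or> i = 3"
  by linarith

lemma side_expand: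
  "side v 0 = v ! 1 - v ! 0" "side v 1 = v ! 2 - v ! 1"
  "side v 2 = v ! 3 - v ! 2" "side v 3 = v ! 0 - v ! 3"
  unfolding side_def Suc_mod_4 by (fact refl)+

lemma side_3: "side v 3 = - (side v 0 + side v 1 + side v 2)"
  unfolding side_expand by simp

lemma unit_rhombus_side:
  assumes "v \<in> unit_rhombi" "i < 4"
  shows "side v i \<bullet> side v i = 1"
proof -
  have "dist (v ! i) (v ! (Suc i mod 4)) = 1" using assms by (simp add: integral_curves_def)
  then have "norm (side v i) = 1" by (simp add: side_def dist_norm norm_minus_commute)
  then show ?thesis by (simp add: norm_eq_1)
qed

text \<open>The fourth side also has length 1, which ties the remaining cosine to the other
  two.\<close>

lemma unit_rhombus_cos:
  assumes "v \<in> unit_rhombi"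
  shows "side v 0 \<bullet> side v 2 = - 1 - cos_1 v - cos_2 v"
proof -
  have "(side v 0 + side v 1 + side v 2) \<bullet> (side v 0 + side v 1 + side v 2) = 1"
    using unit_rhombus_side[OF assms, of 3] unfolding side_3
    by (simp only: inner_minus_left inner_minus_right minus_minus)
  then show ?thesis
    using unit_rhombus_side[OF assms, of 0] unit_rhombus_side[OF assms, of 1] unit_rhombus_side[OF assms, of 2]
    by (simp add: inner_simps inner_commute cos_1_def cos_2_def)
qed

lemma add_eq_0_if_unit:
  fixes x y :: "'a::real_inner"
  assumes "x \<bullet> x = 1" "y \<bullet> y = 1" "x \<bullet> y = - 1"
  shows "x + y = 0"
proof -
  have "(x + y) \<bullet> (x + y) = 0" using assms by (simp add: inner_simps inner_commute)
  then show ?thesis by simp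
qed

text \<open>With \<open>a\<close>, \<open>b\<close>, \<open>c\<close> the cosines between the first three sides, the Gram determinant is
  \<open>2 (1 + a) (1 + b) (1 + c)\<close> because \<open>1 + a + b + c = 0\<close>.\<close>

lemma planar_rhombus:
  assumes v: "v \<in> unit_rhombi" and "spat v = 0"
  shows "side v 0 + side v 1 = 0 \<and> side v 2 + side v 3 = 0 \<or>
    side v 1 + side v 2 = 0 \<and> side v 0 + side v 3 = 0 \<or>
    side v 0 + side v 2 = 0 \<and> side v 1 + side v 3 = 0"
proof -
  define a b where "a = cos_1 v" and "b = cos_2 v"
  have u: "side v 0 \<bullet> side v 0 = 1" "side v 1 \<bullet> side v 1 = 1" "side v 2 \<bullet> side v 2 = 1"
    using unit_rhombus_side[OF v] by auto
  have ab: "side v 0 \<bullet> side v 1 = a" "side v 1 \<bullet> side v 2 = b" "side v 0 \<bullet> side v 2 = - 1 - a - b"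
    "side v 1 \<bullet> side v 0 = a" "side v 2 \<bullet> side v 1 = b" "side v 2 \<bullet> side v 0 = - 1 - a - b"
    using unit_rhombus_cos[OF v] by (simp_all add: a_def b_def cos_1_def cos_2_def inner_commute)
  have "0 = spat v * spat v" using assms by simp
  also have "\<dots> = 2 * (1 + a) * (1 + b) * (- a - b)"
    unfolding spat_def triple_product_mult u ab by algebra
  finally have "1 + a = 0 \<or> 1 + b = 0 \<or> - a - b = 0" by auto
  then have "side v 0 + side v 1 = 0 \<or> side v 1 + side v 2 = 0 \<or> side v 0 + side v 2 = 0"
    using u ab add_eq_0_if_unit[of "side v 0" "side v 1"] add_eq_0_if_unit[of "side v 1" "side v 2"]
      add_eq_0_if_unit[of "side v 0" "side v 2"] by linarith
  then show ?thesis by (auto simp: side_3 algebra_simps add_eq_0_iff)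
qed

lemma polygon_form_rhombus:
  assumes "length v = 4"
  shows "polygon_form D D' v = edge_form D D' (side v 0) + edge_form D D' (side v 1) +
    edge_form D D' (side v 2) + edge_form D D' (side v 3)"
proof -
  obtain a b c d where "v = [a, b, c, d]" using assms by (rule length_4E)
  then show ?thesis unfolding polygon_form_def side_expand by (simp add: sides_4)
qed

text \<open>After multiplication by \<open>spat v\<close> everything is expressed by inner products,
  and the claim becomes a polynomial identity. No division occurs, so planar rhombi are
  included.\<close>

lemma rhombus_form_spat:
  assumes v: "v \<in> unit_rhombi" and D: "derivation D" "derivation D'"
  shows "polygon_form D D' v * spat v = D (cos_2 v) * D' (cos_1 v) - D (cos_1 v) * D' (cos_2 v)"
proof -
  define e where "e = side v"
  define u where "u i = vec_derivation D (e i)" for i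
  define w where "w i = vec_derivation D' (e i)" for i
  define a b where "a = cos_1 v" and "b = cos_2 v"
  have uu: "e 0 \<bullet> e 0 = 1" "e 1 \<bullet> e 1 = 1" "e 2 \<bullet> e 2 = 1" "e 3 \<bullet> e 3 = 1"
    using unit_rhombus_side[OF v] by (auto simp: e_def)
  have ab: "e 0 \<bullet> e 1 = a" "e 1 \<bullet> e 2 = b" "e 0 \<bullet> e 2 = - 1 - a - b"
    "e 1 \<bullet> e 0 = a" "e 2 \<bullet> e 1 = b" "e 2 \<bullet> e 0 = - 1 - a - b"
    using unit_rhombus_cos[OF v] by (simp_all add: a_def b_def e_def cos_1_def cos_2_def inner_commute)
  have e3: "e 3 = - (e 0 + e 1 + e 2)" unfolding e_def by (rule side_3)
  \<comment> \<open>The product rule settles six of the nine inner products between the first three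
    sides and their derivatives. The three left over are the freedom of an infinitesimal rotation
    and cancel in the end.\<close>
  have dots: "vec_derivation E (e 0) \<bullet> e 0 = 0" "vec_derivation E (e 1) \<bullet> e 1 = 0" "vec_derivation E (e 2) \<bullet> e 2 = 0"
    "vec_derivation E (e 1) \<bullet> e 0 = E a - vec_derivation E (e 0) \<bullet> e 1"
    "vec_derivation E (e 2) \<bullet> e 1 = E b - vec_derivation E (e 1) \<bullet> e 2"
    "vec_derivation E (e 2) \<bullet> e 0 = - E a - E b - vec_derivation E (e 0) \<bullet> e 2" if E: "derivation E" for E
  proof -
    show "vec_derivation E (e 0) \<bullet> e 0 = 0" "vec_derivation E (e 1) \<bullet> e 1 = 0" "vec_derivation E (e 2) \<bullet> e 2 = 0"
      using uu by (auto intro: vec_derivation_unit[OF E])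
    show "vec_derivation E (e 1) \<bullet> e 0 = E a - vec_derivation E (e 0) \<bullet> e 1"
      using vec_derivation_simps(4)[OF E, of "e 0" "e 1"] unfolding ab by simp
    show "vec_derivation E (e 2) \<bullet> e 1 = E b - vec_derivation E (e 1) \<bullet> e 2"
      using vec_derivation_simps(4)[OF E, of "e 1" "e 2"] unfolding ab by simp
    show "vec_derivation E (e 2) \<bullet> e 0 = - E a - E b - vec_derivation E (e 0) \<bullet> e 2"
      using vec_derivation_simps(4)[OF E, of "e 0" "e 2"] unfolding ab by (simp add: derivation_simps[OF E])
  qed
  note du = dots[OF D(1), folded u_def] and dw = dots[OF D(2), folded w_def]
  have sp: "spat v = e 0 \<bullet> cross3 (e 1) (e 2)" by (simp add: spat_def e_def)
  have f: "edge_form D D' (e i) = e i \<bullet> cross3 (u i) (w i)" for i by (simp add: edge_form_def u_def w_def)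
  have f3: "edge_form D D' (e 3) = - ((e 0 + e 1 + e 2) \<bullet> cross3 (u 0 + u 1 + u 2) (w 0 + w 1 + w 2))"
    unfolding e3 edge_form_minus[OF D]
    by (simp add: edge_form_def vec_derivation_simps[OF D(1)] vec_derivation_simps[OF D(2)] u_def w_def)
  have "length v = 4" using v by (simp add: integral_curves_def)
  note rhombus = polygon_form_rhombus[OF this, folded e_def]
  have lin: "p * s = q1 * s + q2 * s + q3 * s - q4 * s" if "p = q1 + q2 + q3 + - q4"
    for p q1 q2 q3 q4 s :: real
    unfolding that by (simp add: algebra_simps)
  from rhombus
  have "polygon_form D D' v = edge_form D D' (e 0) + edge_form D D' (e 1) + edge_form D D' (e 2) + edge_form D D' (e 3)" .
  then have "polygon_form D D' v * spat v =
    (e 0 \<bullet> cross3 (u 0) (w 0)) * (e 0 \<bullet> cross3 (e 1) (e 2)) +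
    (e 1 \<bullet> cross3 (u 1) (w 1)) * (e 0 \<bullet> cross3 (e 1) (e 2)) +
    (e 2 \<bullet> cross3 (u 2) (w 2)) * (e 0 \<bullet> cross3 (e 1) (e 2)) -
    ((e 0 + e 1 + e 2) \<bullet> cross3 (u 0 + u 1 + u 2) (w 0 + w 1 + w 2)) * (e 0 \<bullet> cross3 (e 1) (e 2))"
    unfolding sp f3 f[of 0] f[of 1] f[of 2] by (rule lin)
  also have "\<dots> = D b * D' a - D a * D' b"
    unfolding triple_product_mult
    unfolding inner_add_left uu ab du dw by algebra
  finally show ?thesis by (simp add: a_def b_def)
qed

text \<open>The third rhombus may be planar, and then the identity above says nothing about its
  form. In that case the sides form two opposite pairs, whose edge forms cancel.\<close>

lemma rhombus_form_rank:
  assumes v: "v \<in> unit_rhombi"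
  shows "\<exists>k. \<forall>D D'. derivation D \<longrightarrow> derivation D' \<longrightarrow>
    polygon_form D D' v = k * (D (cos_1 v) * D' (cos_2 v) - D (cos_2 v) * D' (cos_1 v))"
proof (cases "spat v = 0")
  case True
  have len: "length v = 4" using v by (simp add: integral_curves_def)
  have m: "edge_form D D' x + edge_form D D' y = 0"
    if "derivation D" "derivation D'" "x + y = 0" for D D' x y
    using edge_form_minus[OF that(1,2), of x] that(3) by (simp add: add_eq_0_iff)
  have "polygon_form D D' v = 0" if D: "derivation D" "derivation D'" for D D'
    using planar_rhombus[OF v True]
    unfolding polygon_form_rhombus[OF len]
    by (elim disjE conjE) (use m[OF D] in \<open>fastforce dest: m[OF D] simp: algebra_simps\<close>)+
  then show ?thesis by (intro exI[of _ 0]) simp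
next
  case False
  then show ?thesis
    using rhombus_form_spat[OF v]
    by (intro exI[of _ "- 1 / spat v"]) (auto simp: field_simps)
qed

lemma not_cobordant_if_independent:
  assumes \<rho>: "\<rho>\<^sub>1 \<in> unit_rhombi" "\<rho>\<^sub>2 \<in> unit_rhombi" "\<rho>\<^sub>3 \<in> unit_rhombi"
    and ind: "alg_independent ((!) [cos_1 \<rho>\<^sub>1, cos_2 \<rho>\<^sub>1, cos_1 \<rho>\<^sub>2, cos_2 \<rho>\<^sub>2]) 4"
  shows "\<not> orientably_cobordant \<rho>\<^sub>1 \<rho>\<^sub>2 \<rho>\<^sub>3"
proof
  assume "orientably_cobordant \<rho>\<^sub>1 \<rho>\<^sub>2 \<rho>\<^sub>3"
  moreover have "length \<rho>\<^sub>1 = 4" "length \<rho>\<^sub>2 = 4" "length \<rho>\<^sub>3 = 4" using \<rho> by (auto simp: integral_curves_def)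
  ultimately obtain s1 s2 s3 :: real where s: "s1\<^sup>2 = 1" "s2\<^sup>2 = 1" "s3\<^sup>2 = 1"
    and sum0: "\<And>D D'. derivation D \<Longrightarrow> derivation D' \<Longrightarrow>
      s1 * polygon_form D D' \<rho>\<^sub>1 + s2 * polygon_form D D' \<rho>\<^sub>2 + s3 * polygon_form D D' \<rho>\<^sub>3 = 0"
    using cobordant_forms by metis
  have ex: "\<exists>D. derivation D \<and> D (cos_1 \<rho>\<^sub>1) = b1 \<and> D (cos_2 \<rho>\<^sub>1) = b2 \<and> D (cos_1 \<rho>\<^sub>2) = b3 \<and> D (cos_2 \<rho>\<^sub>2) = b4"
    for b1 b2 b3 b4
  proof -
    obtain D where D: "derivation D"
      "\<forall>k<4. D ([cos_1 \<rho>\<^sub>1, cos_2 \<rho>\<^sub>1, cos_1 \<rho>\<^sub>2, cos_2 \<rho>\<^sub>2] ! k) = [b1, b2, b3, b4] ! k"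
      using alg_independent_derivation[OF ind] by blast
    show ?thesis
      using D(1) D(2)[rule_format, of 0] D(2)[rule_format, of 1] D(2)[rule_format, of 2] D(2)[rule_format, of 3]
      by (intro exI[of _ D]) simp
  qed
  obtain D1 where D1: "derivation D1" "D1 (cos_1 \<rho>\<^sub>1) = 1" "D1 (cos_2 \<rho>\<^sub>1) = 0" "D1 (cos_1 \<rho>\<^sub>2) = 0" "D1 (cos_2 \<rho>\<^sub>2) = 0"
    using ex by blast
  obtain D2 where D2: "derivation D2" "D2 (cos_1 \<rho>\<^sub>1) = 0" "D2 (cos_2 \<rho>\<^sub>1) = 1" "D2 (cos_1 \<rho>\<^sub>2) = 0" "D2 (cos_2 \<rho>\<^sub>2) = 0"
    using ex by blast
  obtain D3 where D3: "derivation D3" "D3 (cos_1 \<rho>\<^sub>1) = 0" "D3 (cos_2 \<rho>\<^sub>1) = 0" "D3 (cos_1 \<rho>\<^sub>2) = 1" "D3 (cos_2 \<rho>\<^sub>2) = 0"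
    using ex by blast
  obtain D4 where D4: "derivation D4" "D4 (cos_1 \<rho>\<^sub>1) = 0" "D4 (cos_2 \<rho>\<^sub>1) = 0" "D4 (cos_1 \<rho>\<^sub>2) = 0" "D4 (cos_2 \<rho>\<^sub>2) = 1"
    using ex by blast
  obtain k1 where k1: "\<And>D D'. derivation D \<Longrightarrow> derivation D' \<Longrightarrow>
    polygon_form D D' \<rho>\<^sub>1 = k1 * (D (cos_1 \<rho>\<^sub>1) * D' (cos_2 \<rho>\<^sub>1) - D (cos_2 \<rho>\<^sub>1) * D' (cos_1 \<rho>\<^sub>1))"
    using rhombus_form_rank[OF \<rho>(1)] by blast
  obtain k2 where k2: "\<And>D D'. derivation D \<Longrightarrow> derivation D' \<Longrightarrow>
    polygon_form D D' \<rho>\<^sub>2 = k2 * (D (cos_1 \<rho>\<^sub>2) * D' (cos_2 \<rho>\<^sub>2) - D (cos_2 \<rho>\<^sub>2) * D' (cos_1 \<rho>\<^sub>2))"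
    using rhombus_form_rank[OF \<rho>(2)] by blast
  obtain k3 where k3: "\<And>D D'. derivation D \<Longrightarrow> derivation D' \<Longrightarrow>
    polygon_form D D' \<rho>\<^sub>3 = k3 * (D (cos_1 \<rho>\<^sub>3) * D' (cos_2 \<rho>\<^sub>3) - D (cos_2 \<rho>\<^sub>3) * D' (cos_1 \<rho>\<^sub>3))"
    using rhombus_form_rank[OF \<rho>(3)] by blast
  \<comment> \<open>Independence itself excludes planar rhombi: on the dual pair of derivations the
    form times \<open>spat\<close> is nonzero.\<close>
  have "k1 * spat \<rho>\<^sub>1 = - 1"
    using rhombus_form_spat[OF \<rho>(1) D1(1) D2(1)] k1[OF D1(1) D2(1)] D1 D2 by simp
  then have "k1 \<noteq> 0" by auto
  have "k2 * spat \<rho>\<^sub>2 = - 1"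
    using rhombus_form_spat[OF \<rho>(2) D3(1) D4(1)] k2[OF D3(1) D4(1)] D3 D4 by simp
  then have "k2 \<noteq> 0" by auto
  \<comment> \<open>The third term is the wedge product of \<open>x\<close> and \<open>y\<close>,
    with its scalar factors absorbed into \<open>x\<close>.\<close>
  define x y where "x D = s3 * k3 * D (cos_1 \<rho>\<^sub>3)" and "y D = D (cos_2 \<rho>\<^sub>3)" for D :: "real \<Rightarrow> real"
  have e12: "s1 * k1 + (x D1 * y D2 - x D2 * y D1) = 0"
    using sum0[OF D1(1) D2(1)] k1[OF D1(1) D2(1)] k2[OF D1(1) D2(1)] k3[OF D1(1) D2(1)] D1 D2
    by (simp add: x_def y_def algebra_simps)
  have e34: "s2 * k2 + (x D3 * y D4 - x D4 * y D3) = 0"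
    using sum0[OF D3(1) D4(1)] k1[OF D3(1) D4(1)] k2[OF D3(1) D4(1)] k3[OF D3(1) D4(1)] D3 D4
    by (simp add: x_def y_def algebra_simps)
  \<comment> \<open>On a mixed pair the first two forms vanish, as each sees the cosines of one
    rhombus only.\<close>
  have e0: "x D * y D' - x D' * y D = 0" if "D \<in> {D1, D2}" "D' \<in> {D3, D4}" for D D'
    using that D1 D2 D3 D4 sum0[of D D'] k1[of D D'] k2[of D D'] k3[of D D']
    by (auto simp: x_def y_def algebra_simps)
  \<comment> \<open>Pluecker relation\<close>
  have "(x D1 * y D2 - x D2 * y D1) * (x D3 * y D4 - x D4 * y D3) =
    (x D1 * y D3 - x D3 * y D1) * (x D2 * y D4 - x D4 * y D2) -
    (x D1 * y D4 - x D4 * y D1) * (x D2 * y D3 - x D3 * y D2)"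
    by (simp add: algebra_simps)
  also have "\<dots> = 0" using e0[of D1 D3] e0[of D1 D4] by simp
  finally have "s1 * k1 * (s2 * k2) = 0"
    using e12 e34 by (metis add_eq_0_iff minus_mult_minus)
  then show False using s \<open>k1 \<noteq> 0\<close> \<open>k2 \<noteq> 0\<close> by auto
qed

section \<open>Coordinates on the moduli space\<close>

lemma isom_plus_side:
  assumes "g \<in> isom_plus" "length v = 4" "i < 4" "j < 4"
  shows "side (map g v) i \<bullet> side (map g v) j = side v i \<bullet> side v j"
proof -
  obtain A b where A: "rotation_matrix A" and g: "g = (\<lambda>x. A *v x + b)"
    using assms(1) by (auto simp: isom_plus_def)
  have "side (map g v) k = A *v side v k" if "k < 4" for k
    using assms(2) that by (simp add: side_def g matrix_vector_mult_diff_distrib)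
  moreover have "orthogonal_transformation ((*v) A)"
    using A by (simp add: rotation_matrix_def orthogonal_transformation_matrix)
  ultimately show ?thesis
    using assms(3,4) by (simp add: orthogonal_transformation_def)
qed

lemma cos_rhombus_class:
  assumes "\<rho> \<in> rhombus_class v"
  shows "\<rho> \<in> unit_rhombi" "cos_1 \<rho> = cos_1 v" "cos_2 \<rho> = cos_2 v"
proof -
  obtain g where g: "g \<in> isom_plus" "\<rho> = map g v" and "v \<in> unit_rhombi" "\<rho> \<in> unit_rhombi"
    using assms by (auto simp: rhombus_class_def congruence_def)
  moreover from this have "length v = 4" by (simp add: integral_curves_def)
  ultimately show "\<rho> \<in> unit_rhombi" "cos_1 \<rho> = cos_1 v" "cos_2 \<rho> = cos_2 v"
    using isom_plus_side[OF g(1)] by (simp_all add: cos_1_def cos_2_def)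
qed

text \<open>Used in contrapositive form: at a planar rhombus in a chart, sides from different
  opposite pairs have nonzero cross product, as \<open>infinitesimal_rotation_2\<close>
  demands.\<close>

lemma all_edges_parallel_if_cross_zero:
  assumes v: "v \<in> unit_rhombi" and "i < 4"
    and sides: "\<And>k. k < 4 \<Longrightarrow> \<exists>c. side v k = c *\<^sub>R side v i \<or> side v k = c *\<^sub>R side v j"
    and cross: "cross3 (side v i) (side v j) = 0"
  shows "all_edges_parallel v"
proof -
  have "cross3 (side v i) (cross3 (side v i) (side v j)) =
      (side v i \<bullet> side v j) *\<^sub>R side v i - (side v i \<bullet> side v i) *\<^sub>R side v j"
    by (simp add: cross3_simps forall_3)
  then have j: "side v j = (side v i \<bullet> side v j) *\<^sub>R side v i"
    using cross unit_rhombus_side[OF v \<open>i < 4\<close>] by simp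
  have "\<exists>c. v ! (Suc k mod 4) - v ! k = c *\<^sub>R side v i" if "k < 4" for k
    using sides[OF that] j unfolding side_def[of v k, symmetric] by (metis scaleR_scaleR)
  moreover have "length v = 4" using v by (simp add: integral_curves_def)
  ultimately show ?thesis
    unfolding all_edges_parallel_def by (intro exI[of _ "side v i"]) simp
qed

lemma linear_functional_kernel:
  fixes L :: "real^2 \<Rightarrow> real"
  assumes "linear L"
  shows "\<exists>h. h \<noteq> 0 \<and> L h = 0"
proof -
  \<comment> \<open>The gradient turned by a right angle. If \<open>L (axis 1 1)\<close> is 0, then
    \<open>axis 1 1\<close> serves instead.\<close>
  define h :: "real^2" where "h = L (axis 2 1) *\<^sub>R axis 1 1 - L (axis 1 1) *\<^sub>R axis 2 1"
  have "L h = 0"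
    using linear_diff[OF assms] linear_scale[OF assms] by (simp add: h_def)
  moreover have "h \<noteq> 0" if "L (axis 1 1) \<noteq> 0"
    using that by (auto simp: h_def vec_eq_iff forall_2 axis_def)
  moreover have "axis 1 1 \<noteq> (0 :: real^2)" by simp
  ultimately show ?thesis by metis
qed

definition cos_vec :: "(real^3) list \<Rightarrow> real^2" where
  "cos_vec v = cos_1 v *\<^sub>R axis 1 1 + cos_2 v *\<^sub>R axis 2 1"

lemma cos_vec_inner:
  "cos_vec v \<bullet> axis 1 1 = cos_1 v" "cos_vec v \<bullet> axis 2 1 = cos_2 v"
  by (simp_all add: cos_vec_def inner_add_left inner_axis_axis)

text \<open>The two cosines are coordinates wherever the rhombus is not planar. Along the planar
  rhombi the immersion condition provides a component of one of the equations \<open>e\<^sub>i + e\<^sub>j = 0\<close>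
  with nonzero differential.\<close>

lemma moduli_chart_coordinates:
  assumes chart: "moduli_chart U \<sigma>"
  shows "\<exists>H'. (\<forall>x\<in>U. ((\<lambda>y. cos_vec (\<sigma> y)) has_derivative H' x) (at x)) \<and>
    (\<forall>h. continuous_on U (\<lambda>x. H' x h)) \<and> negligible {x \<in> U. \<not> inj (H' x)}"
proof -
  have U: "open U" and \<sigma>: "\<And>x. x \<in> U \<Longrightarrow> \<sigma> x \<in> unit_rhombi"
    and np: "\<And>x. x \<in> U \<Longrightarrow> \<not> all_edges_parallel (\<sigma> x)"
    using chart unfolding moduli_chart_def by blast+
  obtain D :: "nat \<Rightarrow> real^2 \<Rightarrow> real^2 \<Rightarrow> real^3" where
    D: "\<forall>i<4. \<forall>x\<in>U. ((\<lambda>y. \<sigma> y ! i) has_derivative D i x) (at x)"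
      "\<forall>i<4. \<forall>h. continuous_on U (\<lambda>x. D i x h)"
      "\<forall>x\<in>U. \<forall>h a b. (\<forall>i<4. D i x h = cross3 a (\<sigma> x ! i) + b) \<longrightarrow> h = 0"
    using chart unfolding moduli_chart_def by blast
  define e where "e i x = side (\<sigma> x) i" for i x
  define u where "u i x h = D (Suc i mod 4) x h - D i x h" for i x h
  have der: "(e i has_derivative u i x) (at x)" if "i < 4" "x \<in> U" for i x
    unfolding e_def u_def side_def
    using D(1) that by (intro has_derivative_diff) auto
  have lin: "linear (u i x)" if "i < 4" "x \<in> U" for i x
    using der[OF that] has_derivative_linear by blast
  have contu: "continuous_on U (\<lambda>x. u i x h)" if "i < 4" for i h
    unfolding u_def using D(2) that by (intro continuous_intros) auto
  have conte: "continuous_on U (e i)" if "i < 4" for i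
    using der[OF that] has_derivative_continuous continuous_at_imp_continuous_on by blast
  have ee: "e i x \<bullet> e i x = 1" if "i < 4" "x \<in> U" for i x
    unfolding e_def using unit_rhombus_side \<sigma> that by blast
  have ue: "u i x h \<bullet> e i x = 0" if "i < 4" "x \<in> U" for i x h
  proof -
    have "((\<lambda>y. e i y \<bullet> e i y) has_derivative (\<lambda>h. e i x \<bullet> u i x h + u i x h \<bullet> e i x)) (at x)"
      by (intro has_derivative_inner der that)
    moreover have "((\<lambda>y. e i y \<bullet> e i y) has_derivative (\<lambda>h. 0)) (at x)"
      by (rule has_derivative_transform_within_open[OF has_derivative_const U that(2)])
        (use ee that in auto)
    ultimately have "(\<lambda>h. e i x \<bullet> u i x h + u i x h \<bullet> e i x) = (\<lambda>h. 0)"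
      by (rule has_derivative_unique)
    then show ?thesis by (simp add: inner_commute fun_eq_iff)
  qed
  \<comment> \<open>The immersion condition in terms of sides: the translation is read off at the
    first vertex, and the other vertices follow along the sides.\<close>
  have imm: "h = 0" if x: "x \<in> U" and a: "\<And>i. i < 4 \<Longrightarrow> u i x h = cross3 a (e i x)" for x h a
  proof -
    define b where "b = D 0 x h - cross3 a (\<sigma> x ! 0)"
    have s: "D (Suc i mod 4) x h - D i x h = cross3 a (\<sigma> x ! (Suc i mod 4)) - cross3 a (\<sigma> x ! i)" if "i < 4" for i
      using a[OF that] by (simp add: u_def e_def side_def Cross3.right_diff_distrib)
    have 0: "D 0 x h = cross3 a (\<sigma> x ! 0) + b" by (simp add: b_def)
    have 1: "D 1 x h = cross3 a (\<sigma> x ! 1) + b" using s[of 0] 0 unfolding Suc_mod_4 by (simp add: algebra_simps)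
    have 2: "D 2 x h = cross3 a (\<sigma> x ! 2) + b" using s[of 1] 1 unfolding Suc_mod_4 by (simp add: algebra_simps)
    have 3: "D 3 x h = cross3 a (\<sigma> x ! 3) + b" using s[of 2] 2 unfolding Suc_mod_4 by (simp add: algebra_simps)
    have "\<forall>i<4. D i x h = cross3 a (\<sigma> x ! i) + b"
      using 0 1 2 3 less_4_cases by blast
    then show ?thesis using D(3) x by blast
  qed
  have u3: "u 3 x h = - (u 0 x h + u 1 x h + u 2 x h)" for x h
    unfolding u_def Suc_mod_4 by (simp add: algebra_simps)
  have e3: "e 3 x = - (e 0 x + e 1 x + e 2 x)" for x
    unfolding e_def by (rule side_3)
  define d where "d i j x h = u i x h \<bullet> e j x + u j x h \<bullet> e i x" for i j x h
  define H' where "H' x h = d 0 1 x h *\<^sub>R axis 1 1 + d 1 2 x h *\<^sub>R (axis 2 1 :: real^2)" for x h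
  have "((\<lambda>y. cos_vec (\<sigma> y)) has_derivative H' x) (at x)" if "x \<in> U" for x
    unfolding cos_vec_def cos_1_def cos_2_def e_def[symmetric] H'_def d_def
    by (auto intro!: derivative_eq_intros der that simp: inner_commute add.commute)
  moreover have "continuous_on U (\<lambda>x. H' x h)" for h
    unfolding H'_def d_def by (intro continuous_intros contu conte) auto
  moreover have "negligible {x \<in> U. \<not> inj (H' x)}"
  proof -
    have inj: "inj (H' x)" if x: "x \<in> U" and n: "spat (\<sigma> x) \<noteq> 0" for x
    proof -
      have "linear (H' x)"
        unfolding H'_def d_def
        using lin[of 0 x] lin[of 1 x] lin[of 2 x] x
        by (auto simp: linear_iff algebra_simps)
      moreover have "h = 0" if "H' x h = 0" for h
      proof -
        have "H' x h \<bullet> axis 1 1 = d 0 1 x h" "H' x h \<bullet> axis 2 1 = d 1 2 x h"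
          by (simp_all add: H'_def inner_add_left inner_axis_axis)
        then have d: "d 0 1 x h = 0" "d 1 2 x h = 0" using that by simp_all
        have "(u 0 x h + u 1 x h + u 2 x h) \<bullet> (e 0 x + e 1 x + e 2 x) = 0"
          using ue[of 3 x h] x unfolding u3 e3
          by (simp only: inner_minus_left inner_minus_right minus_minus)
        \<comment> \<open>Constancy of the length of the fourth side supplies the third inner
          product.\<close>
        then have "d 0 2 x h = 0"
          using d ue[of 0 x h] ue[of 1 x h] ue[of 2 x h] x
          by (simp add: d_def inner_add_left inner_add_right)
        then have "\<exists>a. u 0 x h = cross3 a (e 0 x) \<and> u 1 x h = cross3 a (e 1 x) \<and> u 2 x h = cross3 a (e 2 x)"
          using n d ue x by (intro infinitesimal_rotation_3) (auto simp: d_def spat_def e_def)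
        then obtain a where a: "u 0 x h = cross3 a (e 0 x)" "u 1 x h = cross3 a (e 1 x)" "u 2 x h = cross3 a (e 2 x)"
          by blast
        then have "u 3 x h = cross3 a (e 3 x)" unfolding u3 e3 a by (simp only: cross_minus_right cross_add_right)
        with a have "u i x h = cross3 a (e i x)" if "i < 4" for i
          using less_4_cases[OF that] by blast
        then show ?thesis by (rule imm[OF x])
      qed
      ultimately show ?thesis by (simp add: linear_injective_0)
    qed
    define Z where "Z i j k l = {x \<in> U. e i x + e j x = 0 \<and> e k x + e l x = 0}" for i j k l
    have negZ: "negligible (Z i j k l)"
      if ijkl: "i < 4" "j < 4" "k < 4" "l < 4" "{i, j, k, l} = {0, 1, 2, 3}" for i j k l
    proof -
      define N where "N i j c = {x \<in> U. (e i x + e j x) $ c = 0 \<and> (\<exists>h. (u i x h + u j x h) $ c \<noteq> 0)}"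
        for i j and c :: 3
      have N: "negligible (N i j c)" if "i < 4" "j < 4" for i j c
        unfolding N_def
      proof (rule negligible_regular_zero_set[OF U])
        show "((\<lambda>x. (e i x + e j x) $ c) has_derivative (\<lambda>h. (u i x h + u j x h) $ c)) (at x)"
          if "x \<in> U" for x
          using that \<open>i < 4\<close> \<open>j < 4\<close>
          by (intro bounded_linear.has_derivative[OF bounded_linear_vec_nth] has_derivative_add der)
        show "continuous_on U (\<lambda>x. (u i x h + u j x h) $ c)" for h
          using that by (intro continuous_intros contu)
      qed
      have "Z i j k l \<subseteq> (\<Union>c\<in>UNIV. N i j c) \<union> (\<Union>c\<in>UNIV. N k l c)"
      proof
        fix x assume "x \<in> Z i j k l"
        then have x: "x \<in> U" and z: "e i x + e j x = 0" "e k x + e l x = 0" by (auto simp: Z_def)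
        show "x \<in> (\<Union>c\<in>UNIV. N i j c) \<union> (\<Union>c\<in>UNIV. N k l c)"
        proof (rule ccontr)
          assume "\<not> ?thesis"
          then have "x \<notin> N i j c" "x \<notin> N k l c" for c by auto
          then have "(u i x h + u j x h) $ c = 0" "(u k x h + u l x h) $ c = 0" for h c
            using x z by (simp_all add: N_def del: vector_add_component)
          then have uz: "u i x h + u j x h = 0" "u k x h + u l x h = 0" for h
            by (simp_all add: vec_eq_iff)
          have ej: "e j x = - e i x" "e l x = - e k x" and uj: "u j x h = - u i x h" "u l x h = - u k x h" for h
            using z uz[of h] by (simp_all add: eq_neg_iff_add_eq_0 add.commute)
          have cover: "m \<in> {i, j, k, l}" if "m < 4" for m
            unfolding ijkl(5) using less_4_cases[OF that] by blast
          \<comment> \<open>Both pairs of sides stay opposite to first order, so the shape can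
            change only through the angle between \<open>e i\<close> and \<open>e k\<close>. This is
            one linear condition on a plane of directions: some \<open>h \<noteq> 0\<close> leaves
            the angle fixed, hence rotates the rhombus, against the immersion condition.\<close>
          have "linear (d i k x)"
            unfolding d_def using lin[of i x] lin[of k x] ijkl x
            by (auto simp: linear_iff algebra_simps)
          then obtain h where h: "h \<noteq> 0" "d i k x h = 0" using linear_functional_kernel by blast
          have "cross3 (e i x) (e k x) \<noteq> 0"
          proof
            assume "cross3 (e i x) (e k x) = 0"
            then have "all_edges_parallel (\<sigma> x)"
            proof (intro all_edges_parallel_if_cross_zero[OF \<sigma>[OF x] ijkl(1)])
              fix m :: nat assume "m < 4"
              from cover[OF this]
              have "e m x = 1 *\<^sub>R e i x \<or> e m x = (- 1) *\<^sub>R e i x \<or>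
                  e m x = 1 *\<^sub>R e k x \<or> e m x = (- 1) *\<^sub>R e k x"
                using ej by auto
              then show "\<exists>c. side (\<sigma> x) m = c *\<^sub>R side (\<sigma> x) i \<or> side (\<sigma> x) m = c *\<^sub>R side (\<sigma> x) k"
                unfolding e_def by blast
            qed (simp add: e_def)
            then show False using np x by blast
          qed
          then have "\<exists>a. u i x h = cross3 a (e i x) \<and> u k x h = cross3 a (e k x)"
            using ue x ijkl h(2) by (intro infinitesimal_rotation_2) (auto simp: d_def)
          then obtain a where a: "u i x h = cross3 a (e i x)" "u k x h = cross3 a (e k x)" by blast
          have "u m x h = cross3 a (e m x)" if "m < 4" for m
            using cover[OF that] a ej uj by auto
          then have "h = 0" by (rule imm[OF x])
          then show False using h by simp
        qed
      qed
      moreover have "negligible ((\<Union>c\<in>UNIV. N i j c) \<union> (\<Union>c\<in>UNIV. N k l c))"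
        using ijkl by (intro negligible_Un negligible_Union finite_imageI) (auto simp: N)
      ultimately show ?thesis using negligible_subset by blast
    qed
    have "{x \<in> U. \<not> inj (H' x)} \<subseteq> Z 0 1 2 3 \<union> (Z 1 2 0 3 \<union> Z 0 2 1 3)"
      using inj planar_rhombus \<sigma> by (auto simp: Z_def e_def)
    moreover have "negligible (Z 0 1 2 3 \<union> (Z 1 2 0 3 \<union> Z 0 2 1 3))"
      by (intro negligible_Un negZ) auto
    ultimately show ?thesis using negligible_subset by blast
  qed
  ultimately show ?thesis by blast
qed

section \<open>Assembly in a product of two charts\<close>

lemma negligible_Times_UNIV:
  fixes S :: "'a::euclidean_space set" and T :: "'b::euclidean_space set"
  shows "negligible S \<Longrightarrow> negligible (S \<times> (UNIV :: 'b set))"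
    and "negligible T \<Longrightarrow> negligible ((UNIV :: 'a set) \<times> T)"
proof -
  have *: "negligible (X \<times> Y)" if "X \<in> null_sets lborel \<or> Y \<in> null_sets lborel" "X \<in> sets borel" "Y \<in> sets borel"
    for X :: "'a set" and Y :: "'b set"
  proof -
    have "emeasure (lborel \<Otimes>\<^sub>M lborel) (X \<times> Y) = emeasure lborel X * emeasure lborel Y"
      using that by (intro lborel.emeasure_pair_measure_Times) auto
    then have "emeasure lborel (X \<times> Y) = 0" using that by (auto simp: lborel_prod)
    moreover have "X \<times> Y \<in> sets lborel"
      using that by (metis lborel_prod pair_measureI sets_lborel)
    ultimately show ?thesis
      by (simp add: negligible_iff_null_sets null_sets_completionI null_setsI)
  qed
  \<comment> \<open>A negligible set need not be Borel, so it is enclosed in a Borel null set, to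
    which the product formula applies.\<close>
  have b: "\<exists>X. X \<in> null_sets lborel \<and> S \<subseteq> X" if "negligible S" for S :: "'c::euclidean_space set"
    using that unfolding negligible_iff_null_sets null_sets_completion_iff2 by blast
  show "negligible (S \<times> (UNIV :: 'b set))" if "negligible S"
  proof -
    obtain X where X: "X \<in> null_sets lborel" "S \<subseteq> X" using b[OF \<open>negligible S\<close>] by blast
    then have "negligible (X \<times> (UNIV :: 'b set))" by (intro *) auto
    then show ?thesis by (rule negligible_subset) (use X in auto)
  qed
  show "negligible ((UNIV :: 'a set) \<times> T)" if "negligible T"
  proof -
    obtain X where X: "X \<in> null_sets lborel" "T \<subseteq> X" using b[OF \<open>negligible T\<close>] by blast
    then have "negligible ((UNIV :: 'a set) \<times> X)" by (intro *) auto
    then show ?thesis by (rule negligible_subset) (use X in auto)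
  qed
qed

theorem theorem4p3:
  shows "moduli_pair_null
    {(c\<^sub>1, c\<^sub>2). c\<^sub>1 \<in> rhombus_moduli \<and> c\<^sub>2 \<in> rhombus_moduli \<and>
       (\<exists>\<rho>\<^sub>1\<in>c\<^sub>1. \<exists>\<rho>\<^sub>2\<in>c\<^sub>2. \<exists>\<rho>\<^sub>3\<in>unit_rhombi. orientably_cobordant \<rho>\<^sub>1 \<rho>\<^sub>2 \<rho>\<^sub>3)}"
  (is "moduli_pair_null ?A")
  unfolding moduli_pair_null_def negligible_iff_null_sets[symmetric]
proof (intro allI impI, elim conjE)
  fix U V :: "(real^2) set" and \<sigma> \<tau> :: "real^2 \<Rightarrow> (real^3) list"
  assume chU: "moduli_chart U \<sigma>" and chV: "moduli_chart V \<tau>"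
  have op: "open U" "open V" using chU chV by (auto simp: moduli_chart_def)
  obtain H' where H: "\<And>x. x \<in> U \<Longrightarrow> ((\<lambda>y. cos_vec (\<sigma> y)) has_derivative H' x) (at x)"
    "\<And>h. continuous_on U (\<lambda>x. H' x h)" "negligible {x \<in> U. \<not> inj (H' x)}"
    using moduli_chart_coordinates[OF chU] by blast
  obtain K' where K: "\<And>x. x \<in> V \<Longrightarrow> ((\<lambda>y. cos_vec (\<tau> y)) has_derivative K' x) (at x)"
    "\<And>h. continuous_on V (\<lambda>x. K' x h)" "negligible {x \<in> V. \<not> inj (K' x)}"
    using moduli_chart_coordinates[OF chV] by blast
  define F where "F z = (cos_vec (\<sigma> (fst z)), cos_vec (\<tau> (snd z)))" for z
  define F' where "F' z w = (H' (fst z) (fst w), K' (snd z) (snd w))" for z w :: "(real^2) \<times> (real^2)"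
  \<comment> \<open>Orthonormal vectors that read off the four cosines from \<open>F z\<close>, in
    the order used by \<open>not_cobordant_if_independent\<close>.\<close>
  define E :: "nat \<Rightarrow> (real^2) \<times> (real^2)" where
    "E = (!) [(axis 1 1, 0), (axis 2 1, 0), (0, axis 1 1), (0, axis 2 1)]"
  define N where "N = {z :: (real^2) \<times> (real^2). \<not> alg_independent (\<lambda>k. z \<bullet> E k) 4}"
  have "negligible N"
    unfolding N_def
  proof (rule negligible_alg_dependent)
    show "E j \<bullet> E k = (if j = k then 1 else 0)" if "j < 4" "k < 4" for j k
      using less_4_cases[OF that(1)] less_4_cases[OF that(2)]
      by (elim disjE) (simp_all add: E_def inner_axis_axis)
  qed
  have "negligible {z \<in> U \<times> V. inj (F' z) \<and> F z \<in> N}"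
  proof (rule negligible_preimage_immersion[OF open_Times[OF op] _ _ \<open>negligible N\<close>])
    show "(F has_derivative F' z) (at z)" if "z \<in> U \<times> V" for z
    proof -
      have "((\<lambda>z. cos_vec (\<sigma> (fst z))) has_derivative (\<lambda>w. H' (fst z) (fst w))) (at z)"
        using that by (intro has_derivative_compose[of fst fst z UNIV "\<lambda>y. cos_vec (\<sigma> y)"] H has_derivative_fst has_derivative_ident) auto
      moreover have "((\<lambda>z. cos_vec (\<tau> (snd z))) has_derivative (\<lambda>w. K' (snd z) (snd w))) (at z)"
        using that by (intro has_derivative_compose[of snd snd z UNIV "\<lambda>y. cos_vec (\<tau> y)"] K has_derivative_snd has_derivative_ident) auto
      ultimately show ?thesis unfolding F_def F'_def by (rule has_derivative_Pair)
    qed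
    show "continuous_on (U \<times> V) (\<lambda>z. F' z w)" for w
      unfolding F'_def
      by (intro continuous_on_Pair continuous_on_compose2[OF H(2)] continuous_on_compose2[OF K(2)]
          continuous_on_fst continuous_on_snd continuous_on_id) auto
  qed
  moreover have "negligible ({x \<in> U. \<not> inj (H' x)} \<times> (UNIV :: (real^2) set))"
    "negligible ((UNIV :: (real^2) set) \<times> {x \<in> V. \<not> inj (K' x)})"
    by (intro negligible_Times_UNIV H K)+
  ultimately have neg: "negligible ({z \<in> U \<times> V. inj (F' z) \<and> F z \<in> N} \<union>
      ({x \<in> U. \<not> inj (H' x)} \<times> UNIV \<union> UNIV \<times> {x \<in> V. \<not> inj (K' x)}))"
    by (intro negligible_Un)
  \<comment> \<open>The cosines are invariant under \<open>isom_plus\<close>, so it does not matter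
    which representatives of the two classes are cobordant to a third rhombus.\<close>
  have bad: "F (x, y) \<in> N" if A: "(rhombus_class (\<sigma> x), rhombus_class (\<tau> y)) \<in> ?A" for x y
  proof (rule ccontr)
    assume "F (x, y) \<notin> N"
    then have ind: "alg_independent (\<lambda>k. F (x, y) \<bullet> E k) 4" by (simp add: N_def)
    obtain \<rho>\<^sub>1 \<rho>\<^sub>2 \<rho>\<^sub>3 where \<rho>: "\<rho>\<^sub>1 \<in> rhombus_class (\<sigma> x)" "\<rho>\<^sub>2 \<in> rhombus_class (\<tau> y)" "\<rho>\<^sub>3 \<in> unit_rhombi"
      "orientably_cobordant \<rho>\<^sub>1 \<rho>\<^sub>2 \<rho>\<^sub>3"
      using A by blast
    have "F (x, y) \<bullet> E k = [cos_1 \<rho>\<^sub>1, cos_2 \<rho>\<^sub>1, cos_1 \<rho>\<^sub>2, cos_2 \<rho>\<^sub>2] ! k" if "k < 4" for k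
      using less_4_cases[OF that] cos_rhombus_class[OF \<rho>(1)] cos_rhombus_class[OF \<rho>(2)]
      by (elim disjE) (simp_all add: E_def F_def cos_vec_inner)
    then have "alg_independent ((!) [cos_1 \<rho>\<^sub>1, cos_2 \<rho>\<^sub>1, cos_1 \<rho>\<^sub>2, cos_2 \<rho>\<^sub>2]) 4"
      using ind by (metis alg_independent_cong)
    then show False
      using not_cobordant_if_independent \<rho> cos_rhombus_class(1) by blast
  qed
  have "{(x, y). x \<in> U \<and> y \<in> V \<and> (rhombus_class (\<sigma> x), rhombus_class (\<tau> y)) \<in> ?A} \<subseteq>
    {z \<in> U \<times> V. inj (F' z) \<and> F z \<in> N} \<union>
      ({x \<in> U. \<not> inj (H' x)} \<times> UNIV \<union> UNIV \<times> {x \<in> V. \<not> inj (K' x)})"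
  proof
    fix z assume z: "z \<in> {(x, y). x \<in> U \<and> y \<in> V \<and> (rhombus_class (\<sigma> x), rhombus_class (\<tau> y)) \<in> ?A}"
    obtain x y where xy: "z = (x, y)" by (cases z)
    have *: "x \<in> U \<and> y \<in> V \<and> (rhombus_class (\<sigma> x), rhombus_class (\<tau> y)) \<in> ?A"
      using z unfolding xy by (simp only: mem_Collect_eq prod.case)
    note U = *[THEN conjunct1] *[THEN conjunct2, THEN conjunct1]
    have "inj (F' z)" if "inj (H' x)" "inj (K' y)"
    proof (rule injI)
      fix v w assume "F' z v = F' z w"
      then have eq: "H' x (fst v) = H' x (fst w)" "K' y (snd v) = K' y (snd w)"
        by (simp_all add: F'_def xy)
      show "v = w" by (rule prod_eqI[OF injD[OF that(1) eq(1)] injD[OF that(2) eq(2)]])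
    qed
    moreover have "F z \<in> N" unfolding xy by (rule bad[OF *[THEN conjunct2, THEN conjunct2]])
    ultimately show "z \<in> {z \<in> U \<times> V. inj (F' z) \<and> F z \<in> N} \<union>
      ({x \<in> U. \<not> inj (H' x)} \<times> UNIV \<union> UNIV \<times> {x \<in> V. \<not> inj (K' x)})"
      using U xy by (cases "inj (H' x)"; cases "inj (K' y)") simp_all
  qed
  with neg show "negligible {(x, y). x \<in> U \<and> y \<in> V \<and> (rhombus_class (\<sigma> x), rhombus_class (\<tau> y)) \<in> ?A}"
    by (rule negligible_subset)
qed

end
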